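(* Let $s\ge 1$ and $d\ge 0$ be integers and let $X=Z_1+Z_2+\dots+Z_s\subset\mathbb P^2$ be a general union of $s$ 2-squares. Then $$\dim_{\mathbb C} I(X)_d=\max\left\{0,\ \binom{d+2}{2}-4s\right\},$$ equivalently the Hilbert function of $X$ is $H_X(d)=\dim_{\mathbb C}(S_d/I(X)_d)=\min\left\{\binom{d+2}{2},4s\right\}$.
   Context: Work over $\mathbb C$. Let $S=\mathbb C[x,y,z]$ be the homogeneous coordinate ring of $\mathbb P^2$ and $S_d$ the space of forms of degree $d$, so $\dim S_d=\binom{d+2}{2}$. For a closed subscheme $X\subset\mathbb P^2$, $I(X)\subset S$ denotes its saturated homogeneous ideal and $I(X)_d=I(X)\cap S_d$. A 2-square supported at a point $P\in\mathbb P^2$ is the 0-dimensional subscheme $Z$ with $I(Z)=(L_1^2,L_2^2)$, where $L_1,L_2$ are linearly independent linear forms both vanishing at $P$ (it has length 4). For schemes with pairwise disjoint supports, $X_1+\dots+X_s$ denotes their schematic union. A general union of $s$ 2-squares means that the support points are general points of $\mathbb P^2$ and the pairs of lines $\{L_1=0\},\{L_2=0\}$ through each support point are general. *)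

theory Defs
  imports Complex_Main "HOL-Library.Function_Algebras"
begin

text \<open>Polynomials in C[x,y,z] are represented by their coefficient functions:
  a polynomial is a finitely supported map from exponent triples (a,b,c)
  (standing for the monomial x^a y^b z^c) to complex coefficients.
  Addition is the pointwise addition of functions.\<close>

type_synonym cpoly3 = "nat \<times> nat \<times> nat \<Rightarrow> complex"

definition is_poly3 :: "cpoly3 \<Rightarrow> bool" where
  "is_poly3 f \<longleftrightarrow> finite {m. f m \<noteq> 0}"

definition is_form :: "nat \<Rightarrow> cpoly3 \<Rightarrow> bool" where
  "is_form d f \<longleftrightarrow> (\<forall>a b c. f (a, b, c) \<noteq> 0 \<longrightarrow> a + b + c = d)"

definition pmult :: "cpoly3 \<Rightarrow> cpoly3 \<Rightarrow> cpoly3" where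
  "pmult f g = (\<lambda>(a, b, c). \<Sum>(i, j, k) \<in> {0..a} \<times> {0..b} \<times> {0..c}.
                 f (i, j, k) * g (a - i, b - j, c - k))"

definition linform :: "complex \<Rightarrow> complex \<Rightarrow> complex \<Rightarrow> cpoly3" where
  "linform u v w = (\<lambda>m. if m = (1, 0, 0) then u else if m = (0, 1, 0) then v
                        else if m = (0, 0, 1) then w else 0)"

text \<open>Saturated ideal (L1^2, L2^2) of a 2-square: membership in the ideal generated
  by L1^2 and L2^2 in S.\<close>
definition in_ideal_sq :: "cpoly3 \<Rightarrow> cpoly3 \<Rightarrow> cpoly3 \<Rightarrow> bool" where
  "in_ideal_sq L1 L2 F \<longleftrightarrow>
     (\<exists>G H. is_poly3 G \<and> is_poly3 H \<and> F = pmult (pmult L1 L1) G + pmult (pmult L2 L2) H)"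

text \<open>Parametrisation of a union of s 2-squares by a parameter vector
  prm :: nat => complex.  The i-th 2-square (i < s) is supported at the point
  P_i = [p1 : p2 : 1] with p1 = prm(4i), p2 = prm(4i+1), and its two lines
  through P_i are  L_ij = (x - p1 z) - t_j (y - p2 z)  with slopes
  t_1 = prm(4i+2), t_2 = prm(4i+3).\<close>
definition sq_line :: "(nat \<Rightarrow> complex) \<Rightarrow> nat \<Rightarrow> nat \<Rightarrow> cpoly3" where
  "sq_line prm i j =
     (let p1 = prm (4 * i); p2 = prm (4 * i + 1); t = prm (4 * i + 2 + j)
      in linform 1 (- t) (t * p2 - p1))"

definition IX_d :: "nat \<Rightarrow> (nat \<Rightarrow> complex) \<Rightarrow> nat \<Rightarrow> cpoly3 set" where
  "IX_d s prm d = {F. is_form d F \<and>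
     (\<forall>i < s. in_ideal_sq (sq_line prm i 0) (sq_line prm i 1) F)}"

definition cscale :: "complex \<Rightarrow> cpoly3 \<Rightarrow> cpoly3" where
  "cscale c f = (\<lambda>m. c * f m)"

abbreviation cdim :: "cpoly3 set \<Rightarrow> nat" where
  "cdim V \<equiv> vector_space.dim cscale V"

inductive_set polyfun :: "((nat \<Rightarrow> complex) \<Rightarrow> complex) set" where
  pf_const: "(\<lambda>prm. c) \<in> polyfun"
| pf_var: "(\<lambda>prm. prm i) \<in> polyfun"
| pf_add: "f \<in> polyfun \<Longrightarrow> g \<in> polyfun \<Longrightarrow> (\<lambda>prm. f prm + g prm) \<in> polyfun"
| pf_mult: "f \<in> polyfun \<Longrightarrow> g \<in> polyfun \<Longrightarrow> (\<lambda>prm. f prm * g prm) \<in> polyfun"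

end

theory Submission
  imports Defs "HOL-Library.Poly_Mapping" "HOL-Library.Product_Plus"
begin

text \<open>A form lies in the ideal of a 2-square with slopes \<open>t\<^sub>0 \<noteq> t\<^sub>1\<close> at \<open>(p\<^sub>1, p\<^sub>2)\<close> iff it is killed
  by the ring homomorphism to \<open>\<complex>[u,v]/(u\<^sup>2,v\<^sup>2)\<close> given by \<open>x \<mapsto> p\<^sub>1 + t\<^sub>0 u + t\<^sub>1 v\<close>, \<open>y \<mapsto> p\<^sub>2 + u + v\<close>,
  \<open>z \<mapsto> 1\<close>; these are four linear conditions on its coefficients. By semicontinuity of rank it
  suffices to find, for some set of \<open>min (4 s) (dim S\<^sub>d)\<close> monomials, one configuration whose
  conditions cut out zero in their span. This is done by a toric degeneration: a 2-square at the
  point \<open>(\<tau>\<^sup>w\<^sup>1, \<tau>\<^sup>w\<^sup>2)\<close> only sees, for small \<open>\<tau>\<close>, the four monomials of lowest weight, and its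
  conditions are independent on them when these four lattice points are not collinear. So one
  peels off four lattice points of the triangle at a time.\<close>

section \<open>Cramer's rule with polynomial parameters\<close>

text \<open>One square block of the condition matrix settles both regimes. If \<open>4 * s\<close>
  is at most the number of monomials, the block contains every condition and its right inverse
  produces solutions; otherwise it contains every monomial and its left inverse leaves only the zero
  form. Hence Cramer identities on both sides, with a polynomial \<Phi> whose nonvanishing is the
  open condition. The slopes 0 and -x/y are fixed multiples of x/y, so that after rescaling the
  coefficients the conditions depend on exponents only: they are 1, a, b and b(b - a). The price is
  that for these slopes non-collinearity does not suffice: along a horizontal line b(b - a) is
  affine, so any three points there are dependent. Along a column it is a genuine quadratic and
  three points are independent, which is why the triangle is peeled by columns. Column lengths need
  not be multiples of three, and each quadruple must also be the set of lowest points for some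
  weight; this forces the extra shapes at the end of a column and in the last corner.\<close>

lemma polyfun_sum:
  "(\<And>a. a \<in> A \<Longrightarrow> (\<lambda>p. f p a) \<in> polyfun) \<Longrightarrow> (\<lambda>p. \<Sum>a\<in>A. f p a) \<in> polyfun"
  by (induction A rule: infinite_finite_induct) (auto intro: polyfun.intros)

lemma polyfun_prod:
  "(\<And>a. a \<in> A \<Longrightarrow> (\<lambda>p. f p a) \<in> polyfun) \<Longrightarrow> (\<lambda>p. \<Prod>a\<in>A. f p a) \<in> polyfun"
  by (induction A rule: infinite_finite_induct) (auto intro: polyfun.intros)

lemma polyfun_uminus: "f \<in> polyfun \<Longrightarrow> (\<lambda>p. - f p) \<in> polyfun"
  using pf_mult[OF pf_const[of "-1"], of f] by simp

lemma polyfun_diff: "f \<in> polyfun \<Longrightarrow> g \<in> polyfun \<Longrightarrow> (\<lambda>p. f p - g p) \<in> polyfun"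
  using pf_add[OF _ polyfun_uminus, of f g] by simp

lemma polyfun_if: "f \<in> polyfun \<Longrightarrow> g \<in> polyfun \<Longrightarrow> (\<lambda>p. if b then f p else g p) \<in> polyfun"
  by (cases b) simp_all

lemmas polyfun_intros =
  polyfun_if polyfun_sum polyfun_prod polyfun_uminus polyfun_diff polyfun.intros

text \<open>A Cramer rule valid for all parameters at once: \<open>c\<close> plays the role of the adjugate of the
  square block with columns \<open>A\<close> and rows \<open>R\<close>, and \<open>\<Phi>\<close> that of its determinant. Gaussian
  elimination without division, adding one column at a time, avoids determinants altogether.\<close>

lemma generic_cramer:
  fixes E :: "(nat \<Rightarrow> complex) \<Rightarrow> 'r \<Rightarrow> 'a \<Rightarrow> complex"
  assumes "finite A" "finite I" and E: "\<And>r a. (\<lambda>p. E p r a) \<in> polyfun"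
    and "\<forall>v. (\<forall>r\<in>I. (\<Sum>a\<in>A. E p0 r a * v a) = 0) \<longrightarrow> (\<forall>a\<in>A. v a = 0)"
  shows "\<exists>\<Phi> c R. \<Phi> \<in> polyfun \<and> \<Phi> p0 \<noteq> 0 \<and> R \<subseteq> I \<and> card R = card A \<and>
    (\<forall>a r. (\<lambda>p. c p a r) \<in> polyfun) \<and>
    (\<forall>p. \<forall>a\<in>A. \<forall>a'\<in>A. (\<Sum>r\<in>R. c p a r * E p r a') = (if a = a' then \<Phi> p else 0)) \<and>
    (\<forall>p. \<forall>r\<in>R. \<forall>r'\<in>R. (\<Sum>a\<in>A. E p r a * c p a r') = (if r = r' then \<Phi> p else 0))"
  using assms(1,4)
proof (induction A rule: finite_induct)
  case empty
  show ?case
    by (intro exI[of _ "\<lambda>_. 1"] exI[of _ "\<lambda>_ _ _. 0"] exI[of _ "{}"]) (auto intro: polyfun.intros)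
next
  case (insert x A)
  have "\<forall>a\<in>A. v a = 0" if "\<forall>r\<in>I. (\<Sum>a\<in>A. E p0 r a * v a) = 0" for v
  proof -
    have "(\<Sum>a\<in>insert x A. E p0 r a * (if a = x then 0 else v a)) = (\<Sum>a\<in>A. E p0 r a * v a)" for r
      using insert.hyps by (auto intro!: sum.cong)
    then show ?thesis
      using insert.prems[THEN spec, of "\<lambda>a. if a = x then 0 else v a"] that insert.hyps(2)
      by (metis insertI2)
  qed
  then have "\<forall>v. (\<forall>r\<in>I. (\<Sum>a\<in>A. E p0 r a * v a) = 0) \<longrightarrow> (\<forall>a\<in>A. v a = 0)"
    by blast
  from insert.IH[OF this] obtain \<Phi> c R where poly: "\<Phi> \<in> polyfun" "\<forall>a r. (\<lambda>p. c p a r) \<in> polyfun"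
    and nz: "\<Phi> p0 \<noteq> 0" and R: "R \<subseteq> I" "card R = card A"
    and left_all: "\<forall>p. \<forall>a\<in>A. \<forall>a'\<in>A. (\<Sum>r\<in>R. c p a r * E p r a') = (if a = a' then \<Phi> p else 0)"
    and right_all: "\<forall>p. \<forall>r\<in>R. \<forall>r'\<in>R. (\<Sum>a\<in>A. E p r a * c p a r') = (if r = r' then \<Phi> p else 0)"
    by (elim exE conjE)
  note left = left_all[rule_format] and right = right_all[rule_format]
  have [simp]: "finite R" "finite A" using R assms(2) finite_subset insert.hyps by auto
  \<comment> \<open>\<open>k\<close> is the adjugate applied to the new column \<open>x\<close>. The
    vector with entry \<open>\<Phi> p\<close> at \<open>x\<close> and \<open>- k p a\<close> on
    \<open>A\<close> is annihilated by the rows in \<open>R\<close>, and \<open>w p r\<close> is its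
    value on row \<open>r\<close>: a Schur complement without division.\<close>
  define k where "k p a = (\<Sum>r\<in>R. c p a r * E p r x)" for p a
  define w where "w p r = \<Phi> p * E p r x - (\<Sum>a\<in>A. E p r a * k p a)" for p r
  \<comment> \<open>Otherwise that vector lies in the kernel at \<open>p0\<close>, with nonzero
    entry \<open>\<Phi> p0\<close> at \<open>x\<close>, against injectivity.\<close>
  have "\<exists>r0\<in>I. w p0 r0 \<noteq> 0"
  proof (rule ccontr)
    assume "\<not> (\<exists>r0\<in>I. w p0 r0 \<noteq> 0)"
    moreover have "(\<Sum>a\<in>insert x A. E p0 r a * (if a = x then \<Phi> p0 else - k p0 a)) = w p0 r" for r
    proof -
      have "(\<Sum>a\<in>A. E p0 r a * (if a = x then \<Phi> p0 else - k p0 a)) = (\<Sum>a\<in>A. - (E p0 r a * k p0 a))"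
        using insert.hyps by (intro sum.cong refl) auto
      then show ?thesis using insert.hyps by (simp add: w_def sum_negf)
    qed
    ultimately have "\<forall>r\<in>I. (\<Sum>a\<in>insert x A. E p0 r a * (if a = x then \<Phi> p0 else - k p0 a)) = 0"
      by simp
    then have "\<forall>a\<in>insert x A. (if a = x then \<Phi> p0 else - k p0 a) = 0"
      by (rule insert.prems[THEN spec, THEN mp])
    then show False using nz by simp
  qed
  then obtain r0 where r0: "r0 \<in> I" "w p0 r0 \<noteq> 0" by blast
  have "w p r = 0" if "r \<in> R" for p r
  proof -
    have "(\<Sum>a\<in>A. E p r a * k p a) = (\<Sum>r'\<in>R. (\<Sum>a\<in>A. E p r a * c p a r') * E p r' x)"
      by (simp add: k_def sum_distrib_left sum_distrib_right mult.assoc) (rule sum.swap)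
    also have "\<dots> = (\<Sum>r'\<in>R. if r = r' then \<Phi> p * E p r' x else 0)"
      by (intro sum.cong refl) (simp add: right[OF that])
    also have "\<dots> = \<Phi> p * E p r x" using that by simp
    finally show ?thesis by (simp add: w_def)
  qed
  then have "r0 \<notin> R" using r0 by blast
  \<comment> \<open>\<open>\<rho>\<close> combines the rows of \<open>insert r0 R\<close> so that
    the columns in \<open>A\<close> cancel and \<open>w p r0\<close> remains in column
    \<open>x\<close>. The new adjugate has a multiple of it at \<open>x\<close>, and uses it to
    clear column \<open>x\<close> from the old entries.\<close>
  define \<rho> where "\<rho> p r = (if r = r0 then \<Phi> p else - (\<Sum>a\<in>A. E p r0 a * c p a r))" for p r
  define c' where "c' p a r = (if a = x then \<Phi> p * \<rho> p r
    else w p r0 * (if r = r0 then 0 else c p a r) - k p a * \<rho> p r)" for p a r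
  have sumR: "(\<Sum>r\<in>insert r0 R. f r) = f r0 + (\<Sum>r\<in>R. f r)" for f :: "'r \<Rightarrow> complex"
    using \<open>r0 \<notin> R\<close> by simp
  have sumA: "(\<Sum>a\<in>insert x A. f a) = f x + (\<Sum>a\<in>A. f a)" for f :: "'a \<Rightarrow> complex"
    using insert.hyps by simp
  have \<rho>E: "(\<Sum>r\<in>insert r0 R. \<rho> p r * E p r a') =
      \<Phi> p * E p r0 a' - (\<Sum>a\<in>A. E p r0 a * (\<Sum>r\<in>R. c p a r * E p r a'))" for p a'
  proof -
    have "(\<Sum>r\<in>R. \<rho> p r * E p r a') = (\<Sum>r\<in>R. - (\<Sum>a\<in>A. E p r0 a * c p a r * E p r a'))"
      using \<open>r0 \<notin> R\<close> by (intro sum.cong refl) (auto simp: \<rho>_def sum_distrib_right)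
    also have "\<dots> = - (\<Sum>a\<in>A. E p r0 a * (\<Sum>r\<in>R. c p a r * E p r a'))"
      by (subst sum_negf, subst sum.swap) (simp add: sum_distrib_left mult.assoc)
    finally show ?thesis unfolding sumR by (simp add: \<rho>_def)
  qed
  have \<rho>A: "(\<Sum>r\<in>insert r0 R. \<rho> p r * E p r a') = 0" if "a' \<in> A" for p a'
  proof -
    have "(\<Sum>a\<in>A. E p r0 a * (\<Sum>r\<in>R. c p a r * E p r a')) = (\<Sum>a\<in>A. if a = a' then E p r0 a * \<Phi> p else 0)"
      by (intro sum.cong refl) (simp add: left that)
    also have "\<dots> = E p r0 a' * \<Phi> p" using that by simp
    finally show ?thesis unfolding \<rho>E by simp
  qed
  have \<rho>x: "(\<Sum>r\<in>insert r0 R. \<rho> p r * E p r x) = w p r0" for p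
    unfolding \<rho>E w_def k_def by simp
  have cR: "(\<Sum>r\<in>insert r0 R. (if r = r0 then 0 else c p a r) * E p r a') = (\<Sum>r\<in>R. c p a r * E p r a')"
    for p a a'
    unfolding sumR using \<open>r0 \<notin> R\<close> by (auto intro!: sum.cong)
  have left': "(\<Sum>r\<in>insert r0 R. c' p a r * E p r a') = (if a = a' then \<Phi> p * w p r0 else 0)"
    if "a \<in> insert x A" "a' \<in> insert x A" for p a a'
  proof (cases "a = x")
    case True
    then have "(\<Sum>r\<in>insert r0 R. c' p a r * E p r a') = \<Phi> p * (\<Sum>r\<in>insert r0 R. \<rho> p r * E p r a')"
      by (simp only: sum_distrib_left) (simp add: c'_def mult.assoc)
    then show ?thesis using \<rho>x \<rho>A that True insert.hyps by (cases "a' = x") auto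
  next
    case False
    then have "(\<Sum>r\<in>insert r0 R. c' p a r * E p r a') =
      w p r0 * (\<Sum>r\<in>insert r0 R. (if r = r0 then 0 else c p a r) * E p r a') -
      k p a * (\<Sum>r\<in>insert r0 R. \<rho> p r * E p r a')"
      by (simp only: sum_distrib_left sum_subtractf[symmetric]) (simp add: c'_def algebra_simps)
    also have "\<dots> = w p r0 * (\<Sum>r\<in>R. c p a r * E p r a') - k p a * (\<Sum>r\<in>insert r0 R. \<rho> p r * E p r a')"
      by (simp only: cR)
    finally show ?thesis
      using False \<rho>A[of a' p] \<rho>x[of p] left[of a a' p] that insert.hyps
      by (cases "a' = x") (auto simp: k_def)
  qed
  have right': "(\<Sum>a\<in>insert x A. E p r a * c' p a r') = (if r = r' then \<Phi> p * w p r0 else 0)"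
    if r: "r \<in> insert r0 R" and r': "r' \<in> insert r0 R" for p r r'
  proof -
    define m where "m = (\<Sum>a\<in>A. E p r a * (if r' = r0 then 0 else c p a r'))"
    have "(\<Sum>a\<in>A. E p r a * c' p a r') = w p r0 * m - \<rho> p r' * (\<Sum>a\<in>A. E p r a * k p a)"
      using insert.hyps unfolding sum_distrib_left m_def sum_subtractf[symmetric]
      by (intro sum.cong refl) (auto simp: c'_def algebra_simps)
    then have eq: "(\<Sum>a\<in>insert x A. E p r a * c' p a r') = w p r0 * m + \<rho> p r' * w p r"
      unfolding sumA by (simp add: c'_def w_def algebra_simps)
    show ?thesis
    proof (cases "r = r0")
      case True
      have "m = (if r' = r0 then 0 else - \<rho> p r')" unfolding m_def \<rho>_def using True by simp
      then show ?thesis unfolding eq using True by (auto simp: \<rho>_def)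
    next
      case False
      then have "r \<in> R" using r by simp
      then have "m = (if r = r' then \<Phi> p else 0)"
        unfolding m_def using right[of r r' p] r' False \<open>r \<in> R\<close> by (cases "r' = r0") auto
      then show ?thesis unfolding eq using \<open>r \<in> R\<close> \<open>\<And>r p. r \<in> R \<Longrightarrow> w p r = 0\<close> by auto
    qed
  qed
  show ?case
  proof (intro exI conjI allI ballI)
    show "(\<lambda>p. \<Phi> p * w p r0) \<in> polyfun" "(\<lambda>p. c' p a r) \<in> polyfun" for a r
      unfolding c'_def \<rho>_def w_def k_def by (intro polyfun_intros poly(1) poly(2)[rule_format] E)+
    show "\<Phi> p0 * w p0 r0 \<noteq> 0" using nz r0 by simp
    show "insert r0 R \<subseteq> I" using r0 R by simp
    show "card (insert r0 R) = card (insert x A)" using R \<open>r0 \<notin> R\<close> insert.hyps by simp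
  qed (fact left' right')+
qed

section \<open>Ideals of 2-squares\<close>

text \<open>\<open>Sq a b c d\<close> stands for \<open>a + b u + c v + d u v\<close> in \<open>\<complex>[u,v]/(u\<^sup>2,v\<^sup>2)\<close>,
  the coordinate ring of a 2-square.\<close>

datatype sqalg = Sq (q00: complex) (q10: complex) (q01: complex) (q11: complex)

lemma sqalg_eq_iff: "a = b \<longleftrightarrow> q00 a = q00 b \<and> q10 a = q10 b \<and> q01 a = q01 b \<and> q11 a = q11 b"
  by (auto intro: sqalg.expand)

instantiation sqalg :: comm_ring_1
begin

definition "0 = Sq 0 0 0 0"
definition "1 = Sq 1 0 0 0"
definition "a + b = Sq (q00 a + q00 b) (q10 a + q10 b) (q01 a + q01 b) (q11 a + q11 b)"
definition "a - b = Sq (q00 a - q00 b) (q10 a - q10 b) (q01 a - q01 b) (q11 a - q11 b)"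
definition "- a = Sq (- q00 a) (- q10 a) (- q01 a) (- q11 a)"
definition "a * b = Sq (q00 a * q00 b) (q00 a * q10 b + q10 a * q00 b)
  (q00 a * q01 b + q01 a * q00 b) (q00 a * q11 b + q10 a * q01 b + q01 a * q10 b + q11 a * q00 b)"

instance
  by standard (simp_all add: zero_sqalg_def one_sqalg_def plus_sqalg_def minus_sqalg_def
    uminus_sqalg_def times_sqalg_def algebra_simps)

end

lemmas sqalg_defs =
  zero_sqalg_def one_sqalg_def plus_sqalg_def minus_sqalg_def uminus_sqalg_def times_sqalg_def

lemma sqalg_sum_sel:
  "q00 (\<Sum>a\<in>A. f a) = (\<Sum>a\<in>A. q00 (f a))" "q10 (\<Sum>a\<in>A. f a) = (\<Sum>a\<in>A. q10 (f a))"
  "q01 (\<Sum>a\<in>A. f a) = (\<Sum>a\<in>A. q01 (f a))" "q11 (\<Sum>a\<in>A. f a) = (\<Sum>a\<in>A. q11 (f a))"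
  by (induction A rule: infinite_finite_induct) (simp_all add: zero_sqalg_def plus_sqalg_def)

definition sconst :: "complex \<Rightarrow> sqalg" where "sconst c = Sq c 0 0 0"

lemma sconst_simps [simp]:
  "sconst 0 = 0" "sconst 1 = 1" "sconst (c + d) = sconst c + sconst d"
  "sconst (c * d) = sconst c * sconst d" "sconst (- c) = - sconst c" "sconst (c - d) = sconst c - sconst d"
  by (simp_all add: sconst_def sqalg_defs)

lemma sconst_mult_sel [simp]:
  "q00 (sconst c * a) = c * q00 a" "q10 (sconst c * a) = c * q10 a"
  "q01 (sconst c * a) = c * q01 a" "q11 (sconst c * a) = c * q11 a"
  by (simp_all add: sconst_def times_sqalg_def)

section \<open>Coefficient functions as elements of a commutative ring\<close>

abbreviation "lookup \<equiv> Poly_Mapping.lookup"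
abbreviation "keys \<equiv> Poly_Mapping.keys"

type_synonym mpoly3 = "nat \<times> nat \<times> nat \<Rightarrow>\<^sub>0 complex"

lemma poly_mapping_sum_single: "(\<Sum>m\<in>keys f. Poly_Mapping.single m (lookup f m)) = f"
  by (rule poly_mapping_eqI)
    (auto simp: lookup_sum lookup_single when_def sum.delta' in_keys_iff)

lemma pmult_sum_left: "pmult (\<lambda>m. \<Sum>i\<in>I. f i m) g = (\<lambda>m. \<Sum>i\<in>I. pmult (f i) g m)"
proof (rule ext, clarify)
  fix a b c
  show "pmult (\<lambda>m. \<Sum>i\<in>I. f i m) g (a, b, c) = (\<Sum>i\<in>I. pmult (f i) g (a, b, c))"
    by (simp add: pmult_def case_prod_unfold sum_distrib_right) (rule sum.swap)
qed

lemma pmult_sum_right: "pmult f (\<lambda>m. \<Sum>i\<in>I. g i m) = (\<lambda>m. \<Sum>i\<in>I. pmult f (g i) m)"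
proof (rule ext, clarify)
  fix a b c
  show "pmult f (\<lambda>m. \<Sum>i\<in>I. g i m) (a, b, c) = (\<Sum>i\<in>I. pmult f (g i) (a, b, c))"
    by (simp add: pmult_def case_prod_unfold sum_distrib_left) (rule sum.swap)
qed

lemma pmult_single:
  "pmult (lookup (Poly_Mapping.single m c)) (lookup (Poly_Mapping.single m' c')) =
    lookup (Poly_Mapping.single (m + m') (c * c'))"
proof (rule ext)
  fix k :: "nat \<times> nat \<times> nat"
  obtain a b e where k: "k = (a, b, e)" by (cases k)
  obtain a1 b1 e1 where m: "m = (a1, b1, e1)" by (cases m)
  obtain a2 b2 e2 where m': "m' = (a2, b2, e2)" by (cases m')
  have "pmult (lookup (Poly_Mapping.single m c)) (lookup (Poly_Mapping.single m' c')) k =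
    (\<Sum>x\<in>{0..a} \<times> {0..b} \<times> {0..e}.
      if x = m then c * (if m' = (a - a1, b - b1, e - e1) then c' else 0) else 0)"
    unfolding pmult_def k m m' prod.case
    by (intro sum.cong refl) (auto simp: lookup_single when_def split: if_splits)
  also have "\<dots> = (if m \<in> {0..a} \<times> {0..b} \<times> {0..e} \<and> m' = (a - a1, b - b1, e - e1) then c * c' else 0)"
    by (subst sum.delta) auto
  also have "\<dots> = lookup (Poly_Mapping.single (m + m') (c * c')) k"
    by (auto simp: k m m' lookup_single when_def)
  finally show "pmult (lookup (Poly_Mapping.single m c)) (lookup (Poly_Mapping.single m' c')) k =
    lookup (Poly_Mapping.single (m + m') (c * c')) k" .
qed

text \<open>Both products are bilinear, so comparing them on monomials suffices. Ideal membership
  thereby becomes an identity in the commutative ring \<open>mpoly3\<close>.\<close>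

lemma pmult_lookup: "pmult (lookup f) (lookup g) = lookup (f * g)" for f g :: mpoly3
proof -
  let ?s = "\<lambda>f m. Poly_Mapping.single m (lookup f m)"
  have *: "lookup f = (\<lambda>k. \<Sum>m\<in>keys f. lookup (?s f m) k)" for f :: mpoly3
    by (subst poly_mapping_sum_single[of f, symmetric]) (auto simp: lookup_sum)
  have "f * g = (\<Sum>m\<in>keys f. ?s f m) * (\<Sum>m'\<in>keys g. ?s g m')"
    by (simp add: poly_mapping_sum_single)
  also have "\<dots> = (\<Sum>m\<in>keys f. \<Sum>m'\<in>keys g. Poly_Mapping.single (m + m') (lookup f m * lookup g m'))"
    by (simp add: sum_product mult_single)
  finally show ?thesis
    by (subst *[of f], subst *[of g])
      (simp only: pmult_sum_left pmult_sum_right pmult_single, simp add: fun_eq_iff lookup_sum)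
qed

lemma is_poly3_lookup: "is_poly3 F \<longleftrightarrow> (\<exists>f. F = lookup f)"
  unfolding is_poly3_def by (metis finite_lookup lookup_Abs_poly_mapping)

lemma in_ideal_sq_lookup:
  "in_ideal_sq (lookup L1) (lookup L2) (lookup f) \<longleftrightarrow> (\<exists>g h. f = L1 * L1 * g + L2 * L2 * h)"
proof -
  have "lookup f = pmult (pmult (lookup L1) (lookup L1)) (lookup g) +
      pmult (pmult (lookup L2) (lookup L2)) (lookup h) \<longleftrightarrow> f = L1 * L1 * g + L2 * L2 * h" for g h
    unfolding pmult_lookup poly_mapping_eq_iff by (auto simp: fun_eq_iff lookup_add)
  then show ?thesis unfolding in_ideal_sq_def is_poly3_lookup by metis
qed

section \<open>Evaluation at z = 1 in the coordinate ring of a 2-square\<close>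

definition ev :: "sqalg \<Rightarrow> sqalg \<Rightarrow> mpoly3 \<Rightarrow> sqalg" where
  "ev X Y f = (\<Sum>m\<in>keys f. sconst (lookup f m) * (X ^ fst m * Y ^ fst (snd m)))"

lemma ev_superset:
  "finite M \<Longrightarrow> keys f \<subseteq> M \<Longrightarrow> ev X Y f = (\<Sum>m\<in>M. sconst (lookup f m) * (X ^ fst m * Y ^ fst (snd m)))"
  unfolding ev_def by (intro sum.mono_neutral_left) (auto simp: in_keys_iff)

lemma ev_add: "ev X Y (f + g) = ev X Y f + ev X Y g"
proof -
  have "finite (keys f \<union> keys g)" "keys (f + g) \<subseteq> keys f \<union> keys g"
    using keys_add[of f g] by simp_all
  then show ?thesis
    by (simp add: ev_superset[of "keys f \<union> keys g"] lookup_add distrib_right sum.distrib)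
qed

lemma ev_zero [simp]: "ev X Y 0 = 0" by (simp add: ev_def)

lemma ev_sum: "ev X Y (\<Sum>i\<in>I. f i) = (\<Sum>i\<in>I. ev X Y (f i))"
  by (induction I rule: infinite_finite_induct) (simp_all add: ev_add)

lemma ev_single: "ev X Y (Poly_Mapping.single m c) = sconst c * (X ^ fst m * Y ^ fst (snd m))"
  by (subst ev_superset[of "{m}"]) (auto simp: lookup_single)

lemma ev_mult: "ev X Y (f * g) = ev X Y f * ev X Y g"
proof -
  let ?s = "\<lambda>f m. Poly_Mapping.single m (lookup f m)"
  have "f * g = (\<Sum>m\<in>keys f. ?s f m) * (\<Sum>m'\<in>keys g. ?s g m')"
    by (simp add: poly_mapping_sum_single)
  also have "\<dots> = (\<Sum>m\<in>keys f. \<Sum>m'\<in>keys g. Poly_Mapping.single (m + m') (lookup f m * lookup g m'))"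
    by (simp add: sum_product mult_single)
  finally show ?thesis
    by (simp add: ev_sum ev_single ev_def[of _ _ f] ev_def[of _ _ g] sum_product power_add mult_ac)
qed

lemma ev_one [simp]: "ev X Y 1 = 1"
  using ev_single[of X Y 0 1] by simp

lemma ev_power: "ev X Y (f ^ n) = ev X Y f ^ n"
  by (induction n) (simp_all add: ev_mult)

section \<open>Normal forms modulo the squares of two lines\<close>

definition lform :: "complex \<Rightarrow> complex \<Rightarrow> complex \<Rightarrow> mpoly3" where
  "lform u v w = Poly_Mapping.single (1, 0, 0) u + Poly_Mapping.single (0, 1, 0) v +
    Poly_Mapping.single (0, 0, 1) w"

lemma lookup_lform: "lookup (lform u v w) = linform u v w"
  by (rule ext) (auto simp: lform_def linform_def lookup_add lookup_single when_def)

lemma ev_lform: "ev X Y (lform u v w) = sconst u * X + sconst v * Y + sconst w"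
  by (simp add: lform_def ev_add ev_single)

abbreviation scal :: "complex \<Rightarrow> mpoly3" where "scal c \<equiv> Poly_Mapping.single 0 c"

abbreviation Zvar :: mpoly3 where "Zvar \<equiv> Poly_Mapping.single (0, 0, 1) 1"

lemma scal_mult: "scal (c * d) = scal c * scal d"
  by (simp add: mult_single)

lemma lform_add: "lform u v w + lform u' v' w' = lform (u + u') (v + v') (w + w')"
  by (simp add: lform_def single_add)

lemma scal_lform: "scal c * lform u v w = lform (c * u) (c * v) (c * w)"
  by (simp add: lform_def mult_single distrib_left)

text \<open>The terms with \<open>d - 1\<close> and \<open>d - 2\<close> are present only when these exponents are not truncated.\<close>

definition reducible :: "mpoly3 \<Rightarrow> mpoly3 \<Rightarrow> nat \<Rightarrow> mpoly3 \<Rightarrow> bool" where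
  "reducible L0 L1 d f \<longleftrightarrow> (\<exists>\<alpha> \<beta> \<gamma> \<delta> g h.
     f = L0 * L0 * g + L1 * L1 * h + scal \<alpha> * Zvar ^ d + (scal \<beta> * L0 + scal \<gamma> * L1) * Zvar ^ (d - 1) +
       scal \<delta> * (L0 * L1) * Zvar ^ (d - 2) \<and>
     (d = 0 \<longrightarrow> \<beta> = 0 \<and> \<gamma> = 0) \<and> (d < 2 \<longrightarrow> \<delta> = 0))"

lemma reducibleI:
  assumes "f = L0 * L0 * g + L1 * L1 * h + scal \<alpha> * Zvar ^ d + (scal \<beta> * L0 + scal \<gamma> * L1) * Zvar ^ (d - 1) +
       scal \<delta> * (L0 * L1) * Zvar ^ (d - 2)"
    "d = 0 \<Longrightarrow> \<beta> = 0 \<and> \<gamma> = 0" "d < 2 \<Longrightarrow> \<delta> = 0"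
  shows "reducible L0 L1 d f"
  using assms unfolding reducible_def by blast

lemma reducible_add:
  assumes "reducible L0 L1 d f" "reducible L0 L1 d f'"
  shows "reducible L0 L1 d (f + f')"
proof -
  obtain \<alpha> \<beta> \<gamma> \<delta> g h where 1: "f = L0 * L0 * g + L1 * L1 * h + scal \<alpha> * Zvar ^ d +
       (scal \<beta> * L0 + scal \<gamma> * L1) * Zvar ^ (d - 1) + scal \<delta> * (L0 * L1) * Zvar ^ (d - 2)"
    "d = 0 \<longrightarrow> \<beta> = 0 \<and> \<gamma> = 0" "d < 2 \<longrightarrow> \<delta> = 0" using assms(1) unfolding reducible_def by blast
  obtain \<alpha>' \<beta>' \<gamma>' \<delta>' g' h' where 2: "f' = L0 * L0 * g' + L1 * L1 * h' + scal \<alpha>' * Zvar ^ d +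
       (scal \<beta>' * L0 + scal \<gamma>' * L1) * Zvar ^ (d - 1) + scal \<delta>' * (L0 * L1) * Zvar ^ (d - 2)"
    "d = 0 \<longrightarrow> \<beta>' = 0 \<and> \<gamma>' = 0" "d < 2 \<longrightarrow> \<delta>' = 0" using assms(2) unfolding reducible_def by blast
  show ?thesis
    by (rule reducibleI[of _ _ "g + g'" _ "h + h'" "\<alpha> + \<alpha>'" _ "\<beta> + \<beta>'" "\<gamma> + \<gamma>'" "\<delta> + \<delta>'"])
      (use 1(2,3) 2(2,3) in \<open>auto simp: 1(1) 2(1) single_add algebra_simps\<close>)
qed

lemma reducible_scal:
  assumes "reducible L0 L1 d f"
  shows "reducible L0 L1 d (scal c * f)"
proof -
  obtain \<alpha> \<beta> \<gamma> \<delta> g h where 1: "f = L0 * L0 * g + L1 * L1 * h + scal \<alpha> * Zvar ^ d +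
       (scal \<beta> * L0 + scal \<gamma> * L1) * Zvar ^ (d - 1) + scal \<delta> * (L0 * L1) * Zvar ^ (d - 2)"
    "d = 0 \<longrightarrow> \<beta> = 0 \<and> \<gamma> = 0" "d < 2 \<longrightarrow> \<delta> = 0" using assms unfolding reducible_def by blast
  show ?thesis
    by (rule reducibleI[of _ _ "scal c * g" _ "scal c * h" "c * \<alpha>" _ "c * \<beta>" "c * \<gamma>" "c * \<delta>"])
      (use 1(2,3) in \<open>auto simp: 1(1) scal_mult algebra_simps simp del: mult_single\<close>)
qed

lemma reducible_mult_Z:
  assumes "reducible L0 L1 d f"
  shows "reducible L0 L1 (Suc d) (Zvar * f)"
proof -
  obtain \<alpha> \<beta> \<gamma> \<delta> g h where 1: "f = L0 * L0 * g + L1 * L1 * h + scal \<alpha> * Zvar ^ d +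
       (scal \<beta> * L0 + scal \<gamma> * L1) * Zvar ^ (d - 1) + scal \<delta> * (L0 * L1) * Zvar ^ (d - 2)"
    and 2: "d = 0 \<longrightarrow> \<beta> = 0 \<and> \<gamma> = 0" "d < 2 \<longrightarrow> \<delta> = 0" using assms unfolding reducible_def by blast
  \<comment> \<open>Truncated subtraction: \<open>Zvar * Zvar ^ (d - 1)\<close> is
    \<open>Zvar ^ d\<close> only for \<open>d > 0\<close>, and similarly with \<open>d - 2\<close>.
    Where this fails, the coefficients \<beta>, \<gamma> or \<delta> in front vanish.\<close>
  have Z: "(scal \<beta> * L0 + scal \<gamma> * L1) * (Zvar * Zvar ^ (d - 1)) = (scal \<beta> * L0 + scal \<gamma> * L1) * Zvar ^ d"
    "scal \<delta> * (L0 * L1) * (Zvar * Zvar ^ (d - 2)) = scal \<delta> * (L0 * L1) * Zvar ^ (d - 1)"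
  proof -
    consider "d = 0" | "d = 1" | e where "d = Suc (Suc e)"
      by (metis One_nat_def not0_implies_Suc)
    then show "(scal \<beta> * L0 + scal \<gamma> * L1) * (Zvar * Zvar ^ (d - 1)) = (scal \<beta> * L0 + scal \<gamma> * L1) * Zvar ^ d"
      "scal \<delta> * (L0 * L1) * (Zvar * Zvar ^ (d - 2)) = scal \<delta> * (L0 * L1) * Zvar ^ (d - 1)"
      using 2 by (cases; simp)+
  qed
  have "Zvar * f = L0 * L0 * (Zvar * g) + L1 * L1 * (Zvar * h) + scal \<alpha> * Zvar ^ Suc d +
       (scal \<beta> * L0 + scal \<gamma> * L1) * (Zvar * Zvar ^ (d - 1)) + scal \<delta> * (L0 * L1) * (Zvar * Zvar ^ (d - 2))"
    unfolding 1 by (simp add: algebra_simps)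
  then show ?thesis unfolding Z
    by (intro reducibleI[of _ _ "Zvar * g" _ "Zvar * h" \<alpha> _ \<beta> \<gamma> \<delta>]) (use 2 in auto)
qed

text \<open>Multiplication by \<open>L0\<close> shifts the remainder: \<alpha> becomes the
  coefficient of \<open>L0\<close> and \<gamma> that of \<open>L0 * L1\<close>, while the terms with
  \<beta> and \<delta> acquire the factor \<open>L0 * L0\<close> and are absorbed.\<close>

lemma reducible_mult_L0:
  assumes "reducible L0 L1 d f"
  shows "reducible L0 L1 (Suc d) (L0 * f)"
proof -
  obtain \<alpha> \<beta> \<gamma> \<delta> g h where 1: "f = L0 * L0 * g + L1 * L1 * h + scal \<alpha> * Zvar ^ d +
       (scal \<beta> * L0 + scal \<gamma> * L1) * Zvar ^ (d - 1) + scal \<delta> * (L0 * L1) * Zvar ^ (d - 2)"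
    and 2: "d = 0 \<longrightarrow> \<beta> = 0 \<and> \<gamma> = 0" "d < 2 \<longrightarrow> \<delta> = 0" using assms unfolding reducible_def by blast
  show ?thesis
    by (rule reducibleI[of _ _ "L0 * g + scal \<beta> * Zvar ^ (d - 1) + scal \<delta> * L1 * Zvar ^ (d - 2)" _
          "L0 * h" 0 _ \<alpha> 0 \<gamma>])
      (use 2 in \<open>auto simp: 1 algebra_simps\<close>)
qed

lemma reducible_commute:
  assumes "reducible L0 L1 d f"
  shows "reducible L1 L0 d f"
proof -
  obtain \<alpha> \<beta> \<gamma> \<delta> g h where 1: "f = L0 * L0 * g + L1 * L1 * h + scal \<alpha> * Zvar ^ d +
       (scal \<beta> * L0 + scal \<gamma> * L1) * Zvar ^ (d - 1) + scal \<delta> * (L0 * L1) * Zvar ^ (d - 2)"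
    and 2: "d = 0 \<longrightarrow> \<beta> = 0 \<and> \<gamma> = 0" "d < 2 \<longrightarrow> \<delta> = 0" using assms unfolding reducible_def by blast
  show ?thesis
    by (rule reducibleI[of _ _ h _ g \<alpha> _ \<gamma> \<beta> \<delta>]) (use 2 in \<open>auto simp: 1 algebra_simps\<close>)
qed

lemma reducible_mult_L1: "reducible L0 L1 d f \<Longrightarrow> reducible L0 L1 (Suc d) (L1 * f)"
  using reducible_commute reducible_mult_L0 by blast

lemma reducible_sum:
  "(\<And>i. i \<in> I \<Longrightarrow> reducible L0 L1 d (f i)) \<Longrightarrow> reducible L0 L1 d (\<Sum>i\<in>I. f i)"
proof (induction I rule: infinite_finite_induct)
  case (insert x F)
  then show ?case by (simp add: reducible_add)
qed (auto intro: reducibleI[of _ _ 0 _ 0 0 _ 0 0 0])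

definition pline :: "complex \<Rightarrow> complex \<Rightarrow> complex \<Rightarrow> mpoly3" where
  "pline p1 p2 t = lform 1 (- t) (t * p2 - p1)"

context
  fixes p1 p2 t0 t1 :: complex
  assumes ne: "t0 \<noteq> t1"
begin

text \<open>For distinct slopes \<open>x\<close> and \<open>y\<close> are combinations of the two
  lines and \<open>Zvar\<close>. Building up a monomial one variable at a time thus only multiplies
  by these three forms, and each of them preserves the normal form.\<close>

lemma reducible_single: "reducible (pline p1 p2 t0) (pline p1 p2 t1) (a + b + c) (Poly_Mapping.single (a, b, c) k)"
proof -
  let ?L0 = "pline p1 p2 t0" and ?L1 = "pline p1 p2 t1"
  let ?red = "reducible ?L0 ?L1"
  let ?x = "Poly_Mapping.single (1, 0, 0) 1 :: mpoly3" and ?y = "Poly_Mapping.single (0, 1, 0) 1 :: mpoly3"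
  \<comment> \<open>From L0 - L1 = (t1 - t0)(y - p2 z), solved for y.\<close>
  define \<kappa> where "\<kappa> = 1 / (t1 - t0)"
  have \<kappa>: "\<kappa> * t1 = 1 + \<kappa> * t0" using ne by (simp add: \<kappa>_def field_simps)
  have lf: "?x = lform 1 0 0" "?y = lform 0 1 0" "Zvar = lform 0 0 1" by (simp_all add: lform_def)
  have y: "?y = scal \<kappa> * ?L0 + scal (- \<kappa>) * ?L1 + scal p2 * Zvar"
  proof -
    have "\<kappa> * - t0 + - \<kappa> * - t1 + p2 * 0 = 1" using \<kappa> by simp
    moreover have "\<kappa> * (t0 * p2 - p1) + - \<kappa> * (t1 * p2 - p1) + p2 * 1 = (1 - (\<kappa> * t1 - \<kappa> * t0)) * p2"
      by (simp add: algebra_simps)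
    ultimately show ?thesis unfolding lf pline_def scal_lform lform_add using \<kappa> by simp
  qed
  have x: "?x = ?L0 + scal t0 * ?y + scal (p1 - t0 * p2) * Zvar"
    unfolding lf pline_def scal_lform lform_add
    by (intro arg_cong3[where f = lform]) (auto simp: algebra_simps)
  have mult_y: "?red (Suc d) (?y * f)" if "?red d f" for d f
    unfolding y distrib_right mult.assoc
    by (intro reducible_add reducible_scal reducible_mult_Z reducible_mult_L0 reducible_mult_L1 that)
  have mult_x: "?red (Suc d) (?x * f)" if "?red d f" for d f
    unfolding x distrib_right mult.assoc
    by (intro reducible_add reducible_scal reducible_mult_Z reducible_mult_L0 mult_y that)
  have 0: "?red 0 (Poly_Mapping.single (0, 0, 0) k)"
    by (rule reducibleI[of _ _ 0 _ 0 k _ 0 0 0]) (auto simp: zero_prod_def)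
  have 1: "?red c (Poly_Mapping.single (0, 0, c) k)" for c
  proof (induction c)
    case (Suc c)
    then show ?case using reducible_mult_Z[OF Suc] by (simp add: mult_single)
  qed (fact 0)
  have 2: "?red (b + c) (Poly_Mapping.single (0, b, c) k)" for b
  proof (induction b)
    case (Suc b)
    then show ?case using mult_y[OF Suc] by (simp add: mult_single)
  qed (use 1 in simp)
  show ?thesis
  proof (induction a)
    case (Suc a)
    then show ?case using mult_x[OF Suc] by (simp add: mult_single)
  qed (use 2 in simp)
qed

text \<open>The lines go to \<open>(t1 - t0) v\<close> and \<open>(t0 - t1) u\<close>, so their
  squares vanish. Conversely the four remainder terms of the normal form go to nonzero multiples of
  \<open>1\<close>, \<open>v\<close>, \<open>u\<close> and \<open>u v\<close>, so a form with zero
  image has zero remainder.\<close>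

lemma in_ideal_sq_iff_ev:
  fixes f :: mpoly3
  defines "X \<equiv> Sq p1 t0 t1 0" and "Y \<equiv> Sq p2 1 1 0"
  assumes form: "is_form d (lookup f)"
  shows "in_ideal_sq (lookup (pline p1 p2 t0)) (lookup (pline p1 p2 t1)) (lookup f) \<longleftrightarrow> ev X Y f = 0"
proof -
  let ?L0 = "pline p1 p2 t0" and ?L1 = "pline p1 p2 t1"
  have e0: "ev X Y ?L0 = Sq 0 0 (t1 - t0) 0" and e1: "ev X Y ?L1 = Sq 0 (t0 - t1) 0 0"
    unfolding pline_def ev_lform by (simp_all add: X_def Y_def sconst_def sqalg_defs)
  have sq: "ev X Y (?L0 * ?L0 * g + ?L1 * ?L1 * h) = 0" for g h
    unfolding ev_add ev_mult e0 e1 by (simp add: sqalg_defs)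
  have eZ: "ev X Y Zvar = 1" by (simp add: ev_single)
  show ?thesis
  proof
    assume "in_ideal_sq (lookup ?L0) (lookup ?L1) (lookup f)"
    then show "ev X Y f = 0" unfolding in_ideal_sq_lookup using sq by blast
  next
    assume ev0: "ev X Y f = 0"
    have "reducible ?L0 ?L1 d (Poly_Mapping.single m (lookup f m))" if "m \<in> keys f" for m
    proof -
      obtain a b c where m: "m = (a, b, c)" by (cases m)
      then have "d = a + b + c" using form that unfolding is_form_def by (auto simp: in_keys_iff)
      then show ?thesis using reducible_single m by simp
    qed
    then have "reducible ?L0 ?L1 d f"
      by (subst poly_mapping_sum_single[of f, symmetric]) (rule reducible_sum)
    then obtain \<alpha> \<beta> \<gamma> \<delta> g h where f: "f = ?L0 * ?L0 * g + ?L1 * ?L1 * h + scal \<alpha> * Zvar ^ d +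
       (scal \<beta> * ?L0 + scal \<gamma> * ?L1) * Zvar ^ (d - 1) + scal \<delta> * (?L0 * ?L1) * Zvar ^ (d - 2)"
      unfolding reducible_def by blast
    have "ev X Y f = sconst \<alpha> + sconst \<beta> * Sq 0 0 (t1 - t0) 0 + sconst \<gamma> * Sq 0 (t0 - t1) 0 0
        + sconst \<delta> * (Sq 0 0 (t1 - t0) 0 * Sq 0 (t0 - t1) 0 0)"
      unfolding f by (subst add.assoc, subst add.assoc, subst ev_add, subst sq)
        (simp add: ev_add ev_mult ev_power eZ e0 e1 ev_single)
    also have "\<dots> = Sq \<alpha> (\<gamma> * (t0 - t1)) (\<beta> * (t1 - t0)) (\<delta> * ((t1 - t0) * (t0 - t1)))"
      by (simp add: sconst_def sqalg_defs)
    finally have "\<alpha> = 0" "\<beta> = 0" "\<gamma> = 0" "\<delta> = 0" using ne ev0 by (auto simp: zero_sqalg_def)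
    then have "f = ?L0 * ?L0 * g + ?L1 * ?L1 * h" unfolding f by simp
    then show "in_ideal_sq (lookup ?L0) (lookup ?L1) (lookup f)"
      unfolding in_ideal_sq_lookup by blast
  qed
qed

end

section \<open>Degeneration to lowest weight monomials\<close>

definition sel :: "nat \<Rightarrow> sqalg \<Rightarrow> complex" where
  "sel j q = (if j = 0 then q00 q else if j = 1 then q10 q else if j = 2 then q01 q else q11 q)"

lemma sqalg_eq_0_iff: "q = 0 \<longleftrightarrow> (\<forall>j<4. sel j q = 0)"
proof
  assume *: "\<forall>j<4. sel j q = 0"
  show "q = 0" using *[rule_format, of 0] *[rule_format, of 1] *[rule_format, of 2] *[rule_format, of 3]
    by (simp add: sel_def sqalg_eq_iff zero_sqalg_def)
qed (simp add: sel_def zero_sqalg_def)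

lemma sel_sum: "sel j (\<Sum>m\<in>A. sconst (v m) * f m) = (\<Sum>m\<in>A. sel j (f m) * v m)"
  by (simp add: sel_def sqalg_sum_sel) (simp add: mult.commute)

definition sqX :: "(nat \<Rightarrow> complex) \<Rightarrow> nat \<Rightarrow> sqalg" where
  "sqX prm i = Sq (prm (4 * i)) (prm (4 * i + 2)) (prm (4 * i + 3)) 0"

definition sqY :: "(nat \<Rightarrow> complex) \<Rightarrow> nat \<Rightarrow> sqalg" where
  "sqY prm i = Sq (prm (4 * i + 1)) 1 1 0"

definition sqmon :: "(nat \<Rightarrow> complex) \<Rightarrow> nat \<Rightarrow> nat \<times> nat \<Rightarrow> sqalg" where
  "sqmon prm i m = sqX prm i ^ fst m * sqY prm i ^ snd m"

lemma polyfun_sqmon: "(\<lambda>prm. sel j (sqmon prm i m)) \<in> polyfun"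
proof -
  define P where "P f \<longleftrightarrow> (\<lambda>prm. q00 (f prm)) \<in> polyfun \<and> (\<lambda>prm. q10 (f prm)) \<in> polyfun \<and>
    (\<lambda>prm. q01 (f prm)) \<in> polyfun \<and> (\<lambda>prm. q11 (f prm)) \<in> polyfun" for f :: "(nat \<Rightarrow> complex) \<Rightarrow> sqalg"
  have mult: "P (\<lambda>p. f p * g p)" if "P f" "P g" for f g
    using that unfolding P_def times_sqalg_def sqalg.sel by (intro conjI polyfun.intros) auto
  have pow: "P (\<lambda>p. f p ^ n)" if "P f" for f n
  proof (induction n)
    case 0
    show ?case by (auto simp: P_def one_sqalg_def intro: polyfun.intros)
  next
    case (Suc n)
    then show ?case using mult[OF that Suc] by simp
  qed
  have "P (\<lambda>prm. sqX prm i)" "P (\<lambda>prm. sqY prm i)"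
    by (auto simp: P_def sqX_def sqY_def intro: polyfun.intros)
  then have "P (\<lambda>prm. sqmon prm i m)" unfolding sqmon_def by (intro mult pow)
  then show ?thesis unfolding P_def sel_def by (intro polyfun_if) auto
qed

text \<open>At the parameters \<open>prm\<close>, no nonzero combination of the monomials \<open>x\<^sup>a y\<^sup>b\<close> with
  \<open>(a, b) \<in> A\<close> lies in the ideals of all \<open>s\<close> 2-squares.\<close>

definition imposes :: "(nat \<Rightarrow> complex) \<Rightarrow> nat \<Rightarrow> (nat \<times> nat) set \<Rightarrow> bool" where
  "imposes prm s A \<longleftrightarrow> (\<forall>i<s. prm (4 * i + 2) \<noteq> prm (4 * i + 3)) \<and>
     (\<forall>v. (\<forall>i<s. (\<Sum>m\<in>A. sconst (v m) * sqmon prm i m) = 0) \<longrightarrow> (\<forall>m\<in>A. v m = 0))"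

lemma imposes_rows:
  "(\<forall>i<s. (\<Sum>m\<in>A. sconst (v m) * sqmon prm i m) = 0) \<longleftrightarrow>
    (\<forall>r\<in>{..<s} \<times> {..<4}. (\<Sum>m\<in>A. sel (snd r) (sqmon prm (fst r) m) * v m) = 0)"
  by (auto simp: sqalg_eq_0_iff sel_sum)

text \<open>\<open>generic_cramer\<close> for a constant matrix, the parameter being a dummy. Rows
  outside the chosen \<open>R\<close> get coefficient 0.\<close>

lemma left_inverse:
  fixes E :: "'r \<Rightarrow> 'a \<Rightarrow> complex"
  assumes "finite A" "finite I"
    and "\<And>v. (\<forall>r\<in>I. (\<Sum>a\<in>A. E r a * v a) = 0) \<Longrightarrow> \<forall>a\<in>A. v a = 0"
  obtains c where "\<And>v a. a \<in> A \<Longrightarrow> (\<Sum>r\<in>I. c a r * (\<Sum>a'\<in>A. E r a' * v a')) = v a"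
proof -
  have "\<forall>v. (\<forall>r\<in>I. (\<Sum>a\<in>A. E r a * v a) = 0) \<longrightarrow> (\<forall>a\<in>A. v a = 0)"
    using assms(3) by blast
  from generic_cramer[of A I "\<lambda>_. E" "\<lambda>_. 0", OF assms(1,2) pf_const this]
  obtain \<Phi> c R where \<Phi>: "\<Phi> \<in> polyfun" "\<Phi> (\<lambda>_. 0) \<noteq> 0" "R \<subseteq> I" "card R = card A"
    "\<forall>a r. (\<lambda>p. c p a r) \<in> polyfun"
    and "\<forall>p. \<forall>a\<in>A. \<forall>a'\<in>A. (\<Sum>r\<in>R. c p a r * E r a') = (if a = a' then \<Phi> p else 0)"
    "\<forall>p. \<forall>r\<in>R. \<forall>r'\<in>R. (\<Sum>a\<in>A. E r a * c p a r') = (if r = r' then \<Phi> p else 0)"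
    by (elim exE conjE)
  then have c: "(\<Sum>r\<in>R. c (\<lambda>_. 0) a r * E r a') = (if a = a' then \<Phi> (\<lambda>_. 0) else 0)"
    if "a \<in> A" "a' \<in> A" for a a' using that by blast
  define c' where "c' a r = (if r \<in> R then c (\<lambda>_. 0) a r / \<Phi> (\<lambda>_. 0) else 0)" for a r
  have "(\<Sum>r\<in>I. c' a r * (\<Sum>a'\<in>A. E r a' * v a')) = v a" if "a \<in> A" for v a
  proof -
    have "(\<Sum>r\<in>I. c' a r * (\<Sum>a'\<in>A. E r a' * v a')) = (\<Sum>a'\<in>A. (\<Sum>r\<in>I. c' a r * E r a') * v a')"
      by (simp add: sum_distrib_left sum_distrib_right mult.assoc) (rule sum.swap)
    also have "\<dots> = (\<Sum>a'\<in>A. if a = a' then v a' else 0)"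
    proof (intro sum.cong refl)
      fix a' assume a': "a' \<in> A"
      have "(\<Sum>r\<in>I. c' a r * E r a') = (\<Sum>r\<in>R. c (\<lambda>_. 0) a r * E r a' / \<Phi> (\<lambda>_. 0))"
        by (rule sum.mono_neutral_cong_right) (use assms \<Phi> in \<open>auto simp: c'_def\<close>)
      also have "\<dots> = (\<Sum>r\<in>R. c (\<lambda>_. 0) a r * E r a') / \<Phi> (\<lambda>_. 0)"
        by (simp add: sum_divide_distrib)
      finally show "(\<Sum>r\<in>I. c' a r * E r a') * v a' = (if a = a' then v a' else 0)"
        using c[OF that a'] \<Phi> by auto
    qed
    finally show ?thesis using that assms by simp
  qed
  then show ?thesis using that by blast
qed

text \<open>As \<open>u\<^sup>2 = v\<^sup>2 = 0\<close>, the binomial expansions stop early;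
  \<open>(u + v)\<^sup>2 = 2 u v\<close> accounts for \<open>b (b - 1)\<close>. Dividing by
  \<open>y\<close> instead of lowering exponents keeps the formula valid for \<open>a = 0\<close> or
  \<open>b = 0\<close>.\<close>

lemma sq_power_closed_form:
  assumes "y \<noteq> 0"
  shows "Sq x 0 (- (x / y)) 0 ^ a * Sq y 1 1 0 ^ b =
    Sq (x ^ a * y ^ b) (of_nat b * (x ^ a * y ^ b) / y) ((of_nat b - of_nat a) * (x ^ a * y ^ b) / y)
      ((of_nat b * (of_nat b - 1) - of_nat a * of_nat b) * (x ^ a * y ^ b) / y\<^sup>2)"
proof -
  have "Sq x 0 (- (x / y)) 0 ^ a = Sq (x ^ a) 0 (- of_nat a * x ^ a / y) 0"
    by (induction a) (use assms in \<open>simp_all add: one_sqalg_def times_sqalg_def field_simps\<close>)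
  moreover have "Sq y 1 1 0 ^ b = Sq (y ^ b) (of_nat b * y ^ b / y) (of_nat b * y ^ b / y)
      (of_nat b * (of_nat b - 1) * y ^ b / y\<^sup>2)"
    by (induction b) (use assms in \<open>simp_all add: one_sqalg_def times_sqalg_def field_simps power2_eq_square\<close>)
  ultimately show ?thesis
    using assms by (simp add: times_sqalg_def field_simps power2_eq_square)
qed

text \<open>The conditions that a 2-square with slopes \<open>t\<^sub>0 = 0\<close>, \<open>t\<^sub>1 = - x/y\<close> at the torus point \<open>(x, y)\<close>
  imposes on the rescaled coefficients \<open>x\<^sup>a y\<^sup>b F\<^sub>a\<^sub>b\<close>; they no longer depend on the point.\<close>

definition toric_cond :: "nat \<Rightarrow> nat \<times> nat \<Rightarrow> complex" where
  "toric_cond j m = (if j = 0 then 1 else if j = 1 then of_nat (fst m) else if j = 2 then of_nat (snd m)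
     else of_nat (snd m) * (of_nat (snd m) - of_nat (fst m)))"

definition toric_indep :: "(nat \<times> nat) set \<Rightarrow> bool" where
  "toric_indep B \<longleftrightarrow> (\<forall>v. (\<forall>j<4. (\<Sum>m\<in>B. toric_cond j m * v m) = 0) \<longrightarrow> (\<forall>m\<in>B. v m = 0))"

text \<open>Up to powers of \<open>y\<close>, the four coordinates are sums with weights 1, b, b - a
  and b(b - 1) - ab. The second and third give a; the second added to the fourth gives b(b -
  a).\<close>

lemma toric_cond_sum:
  assumes "x \<noteq> 0" "y \<noteq> 0" "j < 4"
    and eq: "(\<Sum>m\<in>A. sconst (v m) * (Sq x 0 (- (x / y)) 0 ^ fst m * Sq y 1 1 0 ^ snd m)) = 0"
  shows "(\<Sum>m\<in>A. toric_cond j m * (x ^ fst m * y ^ snd m * v m)) = 0"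
proof -
  let ?G = "\<lambda>m. x ^ fst m * y ^ snd m * v m"
  have *: "(\<Sum>m\<in>A. sel j (Sq x 0 (- (x / y)) 0 ^ fst m * Sq y 1 1 0 ^ snd m) * v m) = 0" if "j < 4" for j
    using eq that unfolding sqalg_eq_0_iff sel_sum by simp
  have 0: "(\<Sum>m\<in>A. ?G m) = 0"
    using *[of 0] assms(2) by (simp add: sel_def sq_power_closed_form; simp add: mult_ac)
  have "(\<Sum>m\<in>A. of_nat (snd m) * ?G m / y) = 0"
    using *[of 1] assms(2) by (simp add: sel_def sq_power_closed_form; simp add: mult_ac)
  then have 2: "(\<Sum>m\<in>A. of_nat (snd m) * ?G m) = 0"
    using assms(2) by (simp add: sum_divide_distrib[symmetric])
  have "(\<Sum>m\<in>A. (of_nat (snd m) - of_nat (fst m)) * ?G m / y) = 0"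
    using *[of 2] assms(2) by (simp add: sel_def sq_power_closed_form; simp add: mult_ac)
  then have "(\<Sum>m\<in>A. (of_nat (snd m) - of_nat (fst m)) * ?G m) = 0"
    using assms(2) by (simp add: sum_divide_distrib[symmetric])
  then have 1: "(\<Sum>m\<in>A. of_nat (fst m) * ?G m) = 0"
    using 2 by (simp add: left_diff_distrib sum_subtractf)
  have "(\<Sum>m\<in>A. (of_nat (snd m) * (of_nat (snd m) - 1) - of_nat (fst m) * of_nat (snd m)) * ?G m / y\<^sup>2) = 0"
    using *[of 3] assms(2) by (simp add: sel_def sq_power_closed_form; simp add: mult_ac)
  then have "(\<Sum>m\<in>A. (of_nat (snd m) * (of_nat (snd m) - 1) - of_nat (fst m) * of_nat (snd m)) * ?G m) = 0"
    using assms(2) by (simp add: sum_divide_distrib[symmetric])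
  moreover have "(of_nat (snd m) * (of_nat (snd m) - 1) - of_nat (fst m) * of_nat (snd m)) * ?G m =
    of_nat (snd m) * (of_nat (snd m) - of_nat (fst m)) * ?G m - of_nat (snd m) * ?G m" for m
    by (simp add: algebra_simps)
  ultimately have 3: "(\<Sum>m\<in>A. of_nat (snd m) * (of_nat (snd m) - of_nat (fst m)) * ?G m) = 0"
    using 2 by (simp add: sum_subtractf)
  show ?thesis using 0 1 2 3
    by (cases "j = 0"; cases "j = 1"; cases "j = 2"; simp add: toric_cond_def)
qed

text \<open>The new 2-square is placed at \<open>(\<tau>\<^sup>w\<^sup>1, \<tau>\<^sup>w\<^sup>2)\<close>. As \<open>\<tau> \<rightarrow> 0\<close> its conditions degenerate to the
  toric conditions on the monomials \<open>B\<close> of lowest weight.\<close>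

lemma imposes_peel:
  assumes "finite A" "B \<subseteq> A" and "toric_indep B" and "imposes prm s (A - B)"
    and w: "\<And>b a. b \<in> B \<Longrightarrow> a \<in> A - B \<Longrightarrow> w1 * fst b + w2 * snd b < w1 * fst a + (w2::nat) * snd a"
  shows "\<exists>prm'. imposes prm' (Suc s) A"
proof -
  define C where "C = A - B"
  define I where "I = {..<s} \<times> {..<4::nat}"
  define E where "E r m = sel (snd r) (sqmon prm (fst r) m)" for r m
  have fin [simp]: "finite B" "finite C" "finite I" using assms by (auto simp: C_def I_def intro: finite_subset)
  have A: "A = B \<union> C" "B \<inter> C = {}" using assms by (auto simp: C_def)
  have split: "(\<Sum>m\<in>A. f m) = (\<Sum>m\<in>B. f m) + (\<Sum>m\<in>C. f m)" for f :: "nat \<times> nat \<Rightarrow> complex"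
    unfolding A(1) using A(2) by (simp add: sum.union_disjoint)
  obtain c where c: "\<And>v a. a \<in> C \<Longrightarrow> (\<Sum>r\<in>I. c a r * (\<Sum>a'\<in>C. E r a' * v a')) = v a"
    using left_inverse[of C I E] assms(4) unfolding imposes_def imposes_rows I_def[symmetric] E_def[symmetric] C_def[symmetric]
    by auto
  obtain l where l: "\<And>v a. a \<in> B \<Longrightarrow> (\<Sum>r\<in>{..<4}. l a r * (\<Sum>a'\<in>B. toric_cond r a' * v a')) = v a"
    using left_inverse[of B "{..<4}" toric_cond] assms(3) unfolding toric_indep_def by auto
  \<comment> \<open>The old squares determine the coefficients on \<open>C\<close> from those on
    \<open>B\<close> through \<open>K\<close>; the new square determines the rescaled coefficients
    on \<open>B\<close> from those on \<open>C\<close> through \<open>H\<close>. Neither depends on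
    \<tau>, so \<tau> can be chosen after \<open>D\<close>.\<close>
  define K where "K a b = - (\<Sum>r\<in>I. c a r * E r b)" for a b
  define H where "H b a = - (\<Sum>j<4. l b j * toric_cond j a)" for b a
  define D where "D = (\<Sum>b\<in>B. \<Sum>a\<in>C. norm (H b a) * (\<Sum>b'\<in>B. norm (K a b')))"
  define \<tau> where "\<tau> = 1 / (D + 1)"
  have "D \<ge> 0" unfolding D_def by (intro sum_nonneg mult_nonneg_nonneg) auto
  then have \<tau>: "0 < \<tau>" "\<tau> \<le> 1" "\<tau> * D < 1" by (auto simp: \<tau>_def field_simps)
  define x where "x = complex_of_real \<tau> ^ w1"
  define y where "y = complex_of_real \<tau> ^ w2"
  have [simp]: "x \<noteq> 0" "y \<noteq> 0" using \<tau> by (auto simp: x_def y_def)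
  define prm' where "prm' = prm(4 * s := x, 4 * s + 1 := y, 4 * s + 2 := 0, 4 * s + 3 := - (x / y))"
  have old: "sqmon prm' i m = sqmon prm i m" if "i < s" for i m
  proof -
    have "4 * i + 3 < 4 * s" using that by linarith
    then show ?thesis by (simp add: sqmon_def sqX_def sqY_def prm'_def)
  qed
  have new: "sqmon prm' s m = Sq x 0 (- (x / y)) 0 ^ fst m * Sq y 1 1 0 ^ snd m" for m
    by (simp add: sqmon_def sqX_def sqY_def prm'_def)
  have "imposes prm' (Suc s) A"
    unfolding imposes_def
  proof (intro conjI allI impI)
    fix i assume "i < Suc s"
    show "prm' (4 * i + 2) \<noteq> prm' (4 * i + 3)"
    proof (cases "i = s")
      case False
      then have "4 * i + 3 < 4 * s" using \<open>i < Suc s\<close> by linarith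
      then show ?thesis using assms(4) \<open>i < Suc s\<close> False by (simp add: imposes_def prm'_def)
    qed (simp add: prm'_def)
  next
    fix v assume v: "\<forall>i<Suc s. (\<Sum>m\<in>A. sconst (v m) * sqmon prm' i m) = 0"
    define W where "W m = w1 * fst m + w2 * snd m" for m
    define G where "G m = complex_of_real \<tau> ^ W m * v m" for m
    have "\<forall>i<s. (\<Sum>m\<in>A. sconst (v m) * sqmon prm i m) = 0"
    proof (intro allI impI)
      fix i assume "i < s"
      then show "(\<Sum>m\<in>A. sconst (v m) * sqmon prm i m) = 0"
        using v[rule_format, of i] by (simp add: old)
    qed
    then have "\<forall>r\<in>I. (\<Sum>m\<in>A. E r m * v m) = 0"
      unfolding imposes_rows I_def E_def .
    then have rest: "(\<Sum>m\<in>C. E r m * v m) = - (\<Sum>m\<in>B. E r m * v m)" if "r \<in> I" for r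
      using that by (simp add: split add_eq_0_iff)
    have vC: "v a = (\<Sum>b\<in>B. K a b * v b)" if "a \<in> C" for a
    proof -
      have "v a = (\<Sum>r\<in>I. c a r * - (\<Sum>m\<in>B. E r m * v m))"
        using c[OF that, of v] rest by simp
      also have "\<dots> = (\<Sum>b\<in>B. K a b * v b)"
        by (simp add: K_def sum_distrib_left sum_distrib_right sum_negf mult.assoc) (rule sum.swap)
      finally show ?thesis .
    qed
    have G_xy: "G m = x ^ fst m * y ^ snd m * v m" for m
      by (simp add: G_def W_def x_def y_def power_mult power_add)
    have "(\<Sum>m\<in>A. toric_cond j m * G m) = 0" if "j < 4" for j
      unfolding G_xy by (rule toric_cond_sum[OF \<open>x \<noteq> 0\<close> \<open>y \<noteq> 0\<close> that])
        (use v[rule_format, of s] new in simp)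
    then have toric: "(\<Sum>m\<in>B. toric_cond j m * G m) = - (\<Sum>m\<in>C. toric_cond j m * G m)" if "j < 4" for j
      using that by (simp add: split add_eq_0_iff2)
    have GB: "G b = (\<Sum>a\<in>C. H b a * G a)" if "b \<in> B" for b
    proof -
      have "G b = (\<Sum>j<4. l b j * - (\<Sum>m\<in>C. toric_cond j m * G m))"
        using l[OF that, of G] toric by simp
      also have "\<dots> = (\<Sum>a\<in>C. H b a * G a)"
        by (simp add: H_def sum_distrib_left sum_distrib_right sum_negf mult.assoc) (rule sum.swap)
      finally show ?thesis .
    qed
    \<comment> \<open>Weights are integers, so those on \<open>C\<close> exceed those on
      \<open>B\<close> by at least 1, and going from \<open>B\<close> to \<open>C\<close> and back
      gains a factor \<tau>. The composite contracts by \<open>\<tau> * D < 1\<close>, which forces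
      \<open>S = 0\<close>.\<close>
    define S where "S = (\<Sum>b\<in>B. norm (G b))"
    have "S \<ge> 0" unfolding S_def by (intro sum_nonneg) auto
    have GC: "norm (G a) \<le> \<tau> * S * (\<Sum>b\<in>B. norm (K a b))" if "a \<in> C" for a
    proof -
      have "G a = (\<Sum>b\<in>B. K a b * (complex_of_real \<tau> ^ W a * v b))"
        unfolding G_def vC[OF that] by (simp add: sum_distrib_left mult_ac)
      then have "norm (G a) \<le> (\<Sum>b\<in>B. norm (K a b) * norm (complex_of_real \<tau> ^ W a * v b))"
        by (metis (no_types, lifting) norm_mult norm_sum sum.cong)
      also have "\<dots> \<le> (\<Sum>b\<in>B. norm (K a b) * (\<tau> * S))"
      proof (intro sum_mono mult_left_mono norm_ge_zero)
        fix b assume b: "b \<in> B"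
        then have "W b < W a" using w that unfolding W_def C_def by blast
        then have "\<tau> ^ W a \<le> \<tau> ^ Suc (W b)" using \<tau> by (intro power_decreasing) auto
        then have "norm (complex_of_real \<tau> ^ W a * v b) \<le> \<tau> ^ Suc (W b) * norm (v b)"
          using \<tau> by (simp add: norm_mult norm_power mult_right_mono)
        also have "\<dots> = \<tau> * norm (G b)" using \<tau> by (simp add: G_def norm_mult norm_power)
        also have "\<dots> \<le> \<tau> * S"
          using \<tau> b unfolding S_def by (intro mult_left_mono member_le_sum) auto
        finally show "norm (complex_of_real \<tau> ^ W a * v b) \<le> \<tau> * S" .
      qed
      finally show ?thesis by (simp add: sum_distrib_left mult.commute)
    qed
    have "S \<le> (\<Sum>b\<in>B. \<Sum>a\<in>C. norm (H b a) * (\<tau> * S * (\<Sum>b'\<in>B. norm (K a b'))))"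
      unfolding S_def
    proof (rule sum_mono)
      fix b assume "b \<in> B"
      then have "norm (G b) \<le> (\<Sum>a\<in>C. norm (H b a) * norm (G a))"
        by (subst GB) (auto intro!: sum_norm_le simp: norm_mult)
      also have "\<dots> \<le> (\<Sum>a\<in>C. norm (H b a) * (\<tau> * S * (\<Sum>b'\<in>B. norm (K a b'))))"
        by (intro sum_mono mult_left_mono GC) auto
      finally show "norm (G b) \<le> (\<Sum>a\<in>C. norm (H b a) * (\<tau> * (\<Sum>b\<in>B. norm (G b)) * (\<Sum>b'\<in>B. norm (K a b'))))"
        unfolding S_def .
    qed
    also have "\<dots> = (\<tau> * D) * S"
      unfolding D_def by (simp add: sum_distrib_left sum_distrib_right mult_ac)
    finally have "S * (1 - \<tau> * D) \<le> 0" by (simp add: algebra_simps)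
    then have "S \<le> 0" using \<tau>(3) by (simp add: mult_le_0_iff)
    then have "S = 0" using \<open>S \<ge> 0\<close> by simp
    then have "G b = 0" if "b \<in> B" for b
      using that unfolding S_def by (subst (asm) sum_nonneg_eq_0_iff) auto
    then have vB: "v b = 0" if "b \<in> B" for b using that \<tau> by (simp add: G_def)
    moreover have "v a = 0" if "a \<in> C" for a using vC[OF that] vB by simp
    ultimately show "\<forall>m\<in>A. v m = 0" unfolding A by blast
  qed
  then show ?thesis by blast
qed

text \<open>Without monomials only the slopes matter, and \<open>of_nat\<close> makes them distinct.
  This serves the squares left over once the triangle is exhausted.\<close>

lemma imposes_empty: "\<exists>prm. imposes prm s {}"
  by (rule exI[of _ of_nat]) (simp add: imposes_def)

section \<open>Peeling the lattice triangle\<close>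

lemma toric_indep_subset:
  assumes "toric_indep B" "finite B" "B' \<subseteq> B"
  shows "toric_indep B'"
  unfolding toric_indep_def
proof (intro allI impI)
  fix v assume v: "\<forall>j<4. (\<Sum>m\<in>B'. toric_cond j m * v m) = 0"
  have "(\<Sum>m\<in>B. toric_cond j m * (if m \<in> B' then v m else 0)) = (\<Sum>m\<in>B'. toric_cond j m * v m)" for j
    by (rule sum.mono_neutral_cong_right) (use assms in auto)
  then have "\<forall>m\<in>B. (if m \<in> B' then v m else 0) = 0"
    using assms(1)[unfolded toric_indep_def, THEN spec, of "\<lambda>m. if m \<in> B' then v m else 0"] v by simp
  then show "\<forall>m\<in>B'. v m = 0" using assms(3) by (metis subsetD)
qed

lemma toric_indepI4:
  assumes "distinct [(a1,b1), (a2,b2), (a3,b3), (a4,b4)]"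
    and "\<And>v1 v2 v3 v4. v1 + v2 + v3 + v4 = 0 \<Longrightarrow>
      of_nat a1 * v1 + of_nat a2 * v2 + of_nat a3 * v3 + of_nat a4 * v4 = 0 \<Longrightarrow>
      of_nat b1 * v1 + of_nat b2 * v2 + of_nat b3 * v3 + of_nat b4 * v4 = 0 \<Longrightarrow>
      of_nat b1 * (of_nat b1 - of_nat a1) * v1 + of_nat b2 * (of_nat b2 - of_nat a2) * v2 +
      of_nat b3 * (of_nat b3 - of_nat a3) * v3 + of_nat b4 * (of_nat b4 - of_nat a4) * v4 = (0::complex) \<Longrightarrow>
      v1 = 0 \<and> v2 = 0 \<and> v3 = 0 \<and> v4 = 0"
  shows "toric_indep {(a1,b1), (a2,b2), (a3,b3), (a4,b4)}"
  unfolding toric_indep_def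
proof (intro allI impI)
  fix v assume v: "\<forall>j<4. (\<Sum>m\<in>{(a1,b1), (a2,b2), (a3,b3), (a4,b4)}. toric_cond j m * v m) = 0"
  show "\<forall>m\<in>{(a1,b1), (a2,b2), (a3,b3), (a4,b4)}. v m = 0"
    using assms(2)[of "v (a1,b1)" "v (a2,b2)" "v (a3,b3)" "v (a4,b4)"] assms(1)
      v[rule_format, of 0] v[rule_format, of 1] v[rule_format, of 2] v[rule_format, of 3]
    by (simp add: toric_cond_def add.assoc)
qed

text \<open>The conditions 1 and a eliminate the point off the column. On the column b(b - a) has
  second difference 2, so it detects the remaining relation (1, -2, 1).\<close>

lemma toric_indep_31:
  assumes "a \<noteq> a'"
  shows "toric_indep {(a, b), (a, Suc b), (a, Suc (Suc b)), (a', b')}"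
proof (rule toric_indepI4)
  fix v1 v2 v3 v4 :: complex
  assume e: "v1 + v2 + v3 + v4 = 0" "of_nat a * v1 + of_nat a * v2 + of_nat a * v3 + of_nat a' * v4 = 0"
    "of_nat b * v1 + of_nat (Suc b) * v2 + of_nat (Suc (Suc b)) * v3 + of_nat b' * v4 = 0"
    "of_nat b * (of_nat b - of_nat a) * v1 + of_nat (Suc b) * (of_nat (Suc b) - of_nat a) * v2 +
      of_nat (Suc (Suc b)) * (of_nat (Suc (Suc b)) - of_nat a) * v3 + of_nat b' * (of_nat b' - of_nat a') * v4 = 0"
  have "(of_nat a' - of_nat a) * v4 = 0" using e(1,2) by algebra
  then have 4: "v4 = 0" using assms by simp
  then have 2: "v2 = - 2 * v3" using e(1,3) unfolding of_nat_Suc by algebra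
  then have 1: "v1 = v3" using e(1) 4 by algebra
  have "2 * v3 = 0" using e(4) unfolding 1 2 4 of_nat_Suc by algebra
  then show "v1 = 0 \<and> v2 = 0 \<and> v3 = 0 \<and> v4 = 0" using 1 2 4 by simp
qed (use assms in auto)

text \<open>The affine conditions leave the relation (-1, 1, 1, -1). On it the quadratic condition
  takes the value 2b + 1 - 2b', which is odd because of the cross term -ab.\<close>

lemma toric_indep_22:
  "toric_indep {(a, b), (a, Suc b), (Suc a, b'), (Suc a, Suc b')}"
proof (rule toric_indepI4)
  fix v1 v2 v3 v4 :: complex
  assume e: "v1 + v2 + v3 + v4 = 0"
    "of_nat a * v1 + of_nat a * v2 + of_nat (Suc a) * v3 + of_nat (Suc a) * v4 = 0"
    "of_nat b * v1 + of_nat (Suc b) * v2 + of_nat b' * v3 + of_nat (Suc b') * v4 = 0"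
    "of_nat b * (of_nat b - of_nat a) * v1 + of_nat (Suc b) * (of_nat (Suc b) - of_nat a) * v2 +
      of_nat b' * (of_nat b' - of_nat (Suc a)) * v3 + of_nat (Suc b') * (of_nat (Suc b') - of_nat (Suc a)) * v4 = 0"
  have 3: "v3 = - v4" using e(1,2) unfolding of_nat_Suc by algebra
  then have 1: "v1 = - v2" using e(1) by algebra
  have 4: "v4 = - v2" using e(3) unfolding 1 3 of_nat_Suc by algebra
  have "(2 * of_nat b + 1 - 2 * of_nat b') * v2 = 0" using e(4) unfolding 1 3 4 of_nat_Suc by algebra
  moreover have "2 * of_nat b + 1 - 2 * of_nat b' \<noteq> (0::complex)"
  proof
    assume "2 * of_nat b + 1 - 2 * of_nat b' = (0::complex)"
    then have "of_nat (2 * b + 1) = (of_nat (2 * b') :: complex)" by (simp add: add.commute)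
    then show False unfolding of_nat_eq_iff by presburger
  qed
  ultimately show "v1 = 0 \<and> v2 = 0 \<and> v3 = 0 \<and> v4 = 0" using 1 3 4 by simp
qed auto

text \<open>Shapes for the last corner. The affine conditions leave the relations (1, -1, -1, 1) and
  (1, 0, -2, 1), on which the quadratic one takes the values 7 and 4.\<close>

lemma toric_indep_121:
  "toric_indep {(a, Suc (Suc (Suc 0))), (Suc a, Suc 0), (Suc a, Suc (Suc 0)), (Suc (Suc a), 0)}"
  "toric_indep {(a, Suc (Suc 0)), (Suc a, 0), (Suc a, Suc 0), (Suc (Suc a), 0)}"
proof -
  show "toric_indep {(a, Suc (Suc (Suc 0))), (Suc a, Suc 0), (Suc a, Suc (Suc 0)), (Suc (Suc a), 0)}"
  proof (rule toric_indepI4)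
    fix v1 v2 v3 v4 :: complex
    assume e: "v1 + v2 + v3 + v4 = 0"
      "of_nat a * v1 + of_nat (Suc a) * v2 + of_nat (Suc a) * v3 + of_nat (Suc (Suc a)) * v4 = 0"
      "of_nat (Suc (Suc (Suc 0))) * v1 + of_nat (Suc 0) * v2 + of_nat (Suc (Suc 0)) * v3 + of_nat 0 * v4 = 0"
      "of_nat (Suc (Suc (Suc 0))) * (of_nat (Suc (Suc (Suc 0))) - of_nat a) * v1 +
        of_nat (Suc 0) * (of_nat (Suc 0) - of_nat (Suc a)) * v2 +
        of_nat (Suc (Suc 0)) * (of_nat (Suc (Suc 0)) - of_nat (Suc a)) * v3 +
        of_nat 0 * (of_nat 0 - of_nat (Suc (Suc a))) * v4 = 0"
    have 1: "v1 = v4" using e(1,2) unfolding of_nat_Suc by algebra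
    have 3: "v3 = - v4" using e(1,3) 1 unfolding of_nat_Suc of_nat_0 by algebra
    have 2: "v2 = - v4" using e(1) 1 3 by algebra
    have "7 * v4 = 0" using e(4) unfolding 1 2 3 of_nat_Suc of_nat_0 by algebra
    then show "v1 = 0 \<and> v2 = 0 \<and> v3 = 0 \<and> v4 = 0" using 1 2 3 by simp
  qed auto
  show "toric_indep {(a, Suc (Suc 0)), (Suc a, 0), (Suc a, Suc 0), (Suc (Suc a), 0)}"
  proof (rule toric_indepI4)
    fix v1 v2 v3 v4 :: complex
    assume e: "v1 + v2 + v3 + v4 = 0"
      "of_nat a * v1 + of_nat (Suc a) * v2 + of_nat (Suc a) * v3 + of_nat (Suc (Suc a)) * v4 = 0"
      "of_nat (Suc (Suc 0)) * v1 + of_nat 0 * v2 + of_nat (Suc 0) * v3 + of_nat 0 * v4 = 0"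
      "of_nat (Suc (Suc 0)) * (of_nat (Suc (Suc 0)) - of_nat a) * v1 +
        of_nat 0 * (of_nat 0 - of_nat (Suc a)) * v2 +
        of_nat (Suc 0) * (of_nat (Suc 0) - of_nat (Suc a)) * v3 +
        of_nat 0 * (of_nat 0 - of_nat (Suc (Suc a))) * v4 = 0"
    have 1: "v1 = v4" using e(1,2) unfolding of_nat_Suc by algebra
    have 3: "v3 = - 2 * v4" using e(3) 1 unfolding of_nat_Suc of_nat_0 by algebra
    have 2: "v2 = 0" using e(1) 1 3 by algebra
    have "4 * v4 = 0" using e(4) unfolding 1 2 3 of_nat_Suc of_nat_0 by algebra
    then show "v1 = 0 \<and> v2 = 0 \<and> v3 = 0 \<and> v4 = 0" using 1 2 3 by simp
  qed auto
qed

text \<open>The lattice triangle without the columns left of \<open>c\<close>, the lowest \<open>\<alpha>\<close> points of column \<open>c\<close> and the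
  lowest \<open>\<beta>\<close> points of column \<open>c + 1\<close>.\<close>

definition stair :: "nat \<Rightarrow> nat \<Rightarrow> nat \<Rightarrow> nat \<Rightarrow> (nat \<times> nat) set" where
  "stair d c \<alpha> \<beta> = {(a, b). a + b \<le> d \<and> c \<le> a \<and> (a = c \<longrightarrow> \<alpha> \<le> b) \<and> (a = Suc c \<longrightarrow> \<beta> \<le> b)}"

lemma finite_stair: "finite (stair d c \<alpha> \<beta>)"
  by (rule finite_subset[of _ "{..d} \<times> {..d}"]) (auto simp: stair_def)

definition lowest :: "(nat \<times> nat) set \<Rightarrow> (nat \<times> nat) set \<Rightarrow> bool" where
  "lowest B R \<longleftrightarrow> B \<subseteq> R \<and> (\<exists>w1 w2. \<forall>b\<in>B. \<forall>a\<in>R - B. w1 * fst b + w2 * snd b < w1 * fst a + w2 * snd a)"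

lemma lowestI:
  assumes "B \<subseteq> R" "\<And>a b a' b'. (a, b) \<in> B \<Longrightarrow> (a', b') \<in> R \<Longrightarrow> (a', b') \<notin> B \<Longrightarrow> w1 * a + w2 * b < w1 * a' + (w2::nat) * b'"
  shows "lowest B R"
  unfolding lowest_def using assms by (intro conjI exI[of _ w1] exI[of _ w2]) auto

text \<open>The weight \<open>(d + 1, 1)\<close> realises the lexicographic order, columns first,
  since second coordinates are at most \<open>d\<close>. The pair \<open>(e, f)\<close> is a
  threshold between \<open>B\<close> and the rest.\<close>

lemma lowest_lex:
  assumes "B \<subseteq> stair d c \<alpha> \<beta>"
    and "\<And>a b. (a, b) \<in> B \<Longrightarrow> a < e \<or> a = e \<and> b \<le> f"
    and "\<And>a b. (a, b) \<in> stair d c \<alpha> \<beta> \<Longrightarrow> (a, b) \<notin> B \<Longrightarrow> e < a \<or> a = e \<and> f < b"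
  shows "lowest B (stair d c \<alpha> \<beta>)"
proof (rule lowestI[OF assms(1), where ?w1.0 = "Suc d" and ?w2.0 = 1])
  fix a b a' b'
  assume *: "(a, b) \<in> B" "(a', b') \<in> stair d c \<alpha> \<beta>" "(a', b') \<notin> B"
  then have "b \<le> d" using assms(1) by (auto simp: stair_def)
  have "a < a' \<or> a = a' \<and> b < b'" using assms(2)[OF *(1)] assms(3)[OF *(2,3)] by linarith
  then show "Suc d * a + 1 * b < Suc d * a' + 1 * b'"
  proof
    assume "a < a'"
    then have "Suc d * Suc a \<le> Suc d * a'" by (intro mult_le_mono2) simp
    then show ?thesis using \<open>b \<le> d\<close> by simp
  qed simp
qed

lemma mem_stair: "(a, b) \<in> stair d c \<alpha> \<beta> \<longleftrightarrow>
    a + b \<le> d \<and> c \<le> a \<and> (a = c \<longrightarrow> \<alpha> \<le> b) \<and> (a = Suc c \<longrightarrow> \<beta> \<le> b)"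
  by (simp add: stair_def)

lemma stair_cases:
  assumes "(a, b) \<in> stair d c \<alpha> \<beta>"
  obtains "a = c" "\<alpha> \<le> b" "c + b \<le> d" | "a = Suc c" "\<beta> \<le> b" "Suc c + b \<le> d"
    | "Suc (Suc c) \<le> a" "a + b \<le> d"
proof -
  consider "a = c" | "a = Suc c" | "Suc (Suc c) \<le> a"
    using assms unfolding mem_stair by linarith
  then show thesis using assms that unfolding mem_stair by cases auto
qed

lemma stair_diffI:
  assumes "\<And>a b. (a, b) \<in> stair d c \<alpha> \<beta> \<Longrightarrow> (a, b) \<notin> B \<Longrightarrow> (a, b) \<in> stair d c' \<alpha>' \<beta>'"
    and "\<And>a b. (a, b) \<in> stair d c' \<alpha>' \<beta>' \<Longrightarrow> (a, b) \<in> stair d c \<alpha> \<beta>"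
    and "\<And>a b. (a, b) \<in> stair d c' \<alpha>' \<beta>' \<Longrightarrow> (a, b) \<notin> B"
  shows "stair d c \<alpha> \<beta> - B = stair d c' \<alpha>' \<beta>'"
  using assms by auto

text \<open>Column \<open>c\<close> is used up three points at a time, each triple together with one point of column
  \<open>c + 1\<close>: four points of one column would be collinear. The weight in case 1 places \<open>(c + 1, \<beta>)\<close>
  between \<open>(c, \<alpha> + 2)\<close> and \<open>(c, \<alpha> + 3)\<close>, and \<open>3 \<beta> \<le> \<alpha>\<close> keeps column \<open>c + 2\<close> above them. In the other
  cases at most two points of column \<open>c\<close> are left and the order is lexicographic.\<close>

lemma stair_step:
  assumes "3 * \<beta> \<le> \<alpha>" "c + \<alpha> \<le> d"
  shows "(card (stair d c \<alpha> \<beta>) \<le> 4 \<and> toric_indep (stair d c \<alpha> \<beta>)) \<or>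
    (\<exists>B c' \<alpha>' \<beta>'. card B = 4 \<and> toric_indep B \<and> lowest B (stair d c \<alpha> \<beta>) \<and>
      stair d c \<alpha> \<beta> - B = stair d c' \<alpha>' \<beta>' \<and> 3 * \<beta>' \<le> \<alpha>' \<and> c' + \<alpha>' \<le> Suc d)"
proof -
  let ?R = "stair d c \<alpha> \<beta>"
  have step: ?thesis if "card B = 4" "toric_indep B" "lowest B ?R" "?R - B = stair d c' \<alpha>' \<beta>'"
    "3 * \<beta>' \<le> \<alpha>'" "c' + \<alpha>' \<le> Suc d" for B c' \<alpha>' \<beta>'
    using that by blast
  \<comment> \<open>Column \<open>c\<close> has \<open>d + 1 - c - \<alpha>\<close> points left: at
    least three, two or one in the first three cases. In the last three cases column
    \<open>c + 1\<close> is too short to complete a quadruple; by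
    \<open>3 * \<beta> \<le> \<alpha>\<close> this happens only for
    \<open>d \<le> c + 3\<close>.\<close>
  consider "c + \<alpha> + 2 \<le> d" | "c + \<alpha> + 1 = d" "\<alpha> \<ge> 1" | "c + \<alpha> = d" "\<beta> + 3 \<le> \<alpha>"
    | "c + 3 = d" "\<alpha> = 3" "\<beta> = 1" | "c + 2 = d" "\<alpha> = 2" "\<beta> = 0" | "d \<le> c + 1" "\<beta> = 0"
  proof -
    consider "c + \<alpha> + 2 \<le> d" | "c + \<alpha> + 1 = d" "\<alpha> \<ge> 1" | "c + \<alpha> + 1 = d" "\<alpha> = 0"
      | "c + \<alpha> = d" "\<beta> + 3 \<le> \<alpha>" | "c + \<alpha> = d" "\<alpha> < \<beta> + 3"
      using assms(2) by linarith
    then show thesis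
    proof cases
      case 5
      then have "\<beta> < 2" using assms(1) by linarith
      then consider "\<beta> = 0" "\<alpha> = 0 \<or> \<alpha> = 1 \<or> \<alpha> = 2" | "\<beta> = 1" "\<alpha> = 3"
        using assms(1) 5(2) by linarith
      then show thesis using that(4-6) 5(1) by cases auto
    qed (use that assms in auto)
  qed
  then show ?thesis
  proof cases
    case 1
    let ?B = "{(c, \<alpha>), (c, Suc \<alpha>), (c, Suc (Suc \<alpha>)), (Suc c, \<beta>)}"
    let ?w = "2 * (\<alpha> - \<beta>) + 5"
    show ?thesis
    proof (rule step)
      show "?R - ?B = stair d c (\<alpha> + 3) (\<beta> + 1)"
        by (rule stair_diffI; erule stair_cases) (use 1 assms in \<open>auto simp: mem_stair\<close>)
      show "lowest ?B ?R"
      proof (rule lowestI[where ?w1.0 = ?w and ?w2.0 = 2])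
        show "?B \<subseteq> ?R" using 1 assms by (simp add: mem_stair)
      next
        fix a b a' b' assume *: "(a, b) \<in> ?B" "(a', b') \<in> ?R" "(a', b') \<notin> ?B"
        have le: "?w * a + 2 * b \<le> ?w * c + (2 * \<alpha> + 5)"
          using *(1) assms(1) unfolding insert_iff prod.inject empty_iff by (elim disjE conjE) auto
        from *(2) have "?w * c + (2 * \<alpha> + 5) < ?w * a' + 2 * b'"
        proof (cases rule: stair_cases)
          case 3
          then have "?w * Suc (Suc c) \<le> ?w * a'" by (intro mult_le_mono2)
          then show ?thesis using assms(1) by simp
        qed (use *(3) assms(1) in auto)
        then show "?w * a + 2 * b < ?w * a' + 2 * b'" using le by linarith
      qed
      show "toric_indep ?B" by (rule toric_indep_31) simp
    qed (use 1 assms in simp_all)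
  next
    case 2
    let ?B = "{(c, \<alpha>), (c, Suc \<alpha>), (Suc c, \<beta>), (Suc c, Suc \<beta>)}"
    show ?thesis
    proof (rule step)
      show "?R - ?B = stair d (Suc c) (\<beta> + 2) 0"
        by (rule stair_diffI; erule stair_cases) (use 2 assms in \<open>auto simp: mem_stair\<close>)
      show "lowest ?B ?R"
      proof (rule lowest_lex[where e = "Suc c" and f = "Suc \<beta>"])
        show "?B \<subseteq> ?R" using 2 assms by (simp add: mem_stair)
      next
        fix a b assume "(a, b) \<in> ?R" "(a, b) \<notin> ?B"
        then show "Suc c < a \<or> a = Suc c \<and> Suc \<beta> < b"
          by (elim stair_cases) (use 2 assms in auto)
      qed auto
      show "toric_indep ?B" by (rule toric_indep_22)
    qed (use 2 assms in simp_all)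
  next
    case 3
    let ?B = "{(Suc c, \<beta>), (Suc c, Suc \<beta>), (Suc c, Suc (Suc \<beta>)), (c, \<alpha>)}"
    show ?thesis
    proof (rule step)
      show "?R - ?B = stair d (Suc c) (\<beta> + 3) 0"
        by (rule stair_diffI; erule stair_cases) (use 3 assms in \<open>auto simp: mem_stair\<close>)
      show "lowest ?B ?R"
      proof (rule lowest_lex[where e = "Suc c" and f = "Suc (Suc \<beta>)"])
        show "?B \<subseteq> ?R" using 3 assms by (simp add: mem_stair)
      next
        fix a b assume "(a, b) \<in> ?R" "(a, b) \<notin> ?B"
        then show "Suc c < a \<or> a = Suc c \<and> Suc (Suc \<beta>) < b"
          by (elim stair_cases) (use 3 assms in auto)
      qed auto
      show "toric_indep ?B" by (rule toric_indep_31) simp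
    qed (use 3 assms in simp_all)
  next
    case 4
    let ?B = "{(c, Suc (Suc (Suc 0))), (Suc c, Suc 0), (Suc c, Suc (Suc 0)), (Suc (Suc c), 0)}"
    show ?thesis
    proof (rule step)
      show "?R - ?B = stair d (Suc (Suc c)) (Suc 0) 0"
        by (rule stair_diffI; erule stair_cases) (use 4 assms in \<open>auto simp: mem_stair\<close>)
      show "lowest ?B ?R"
      proof (rule lowest_lex[where e = "Suc (Suc c)" and f = "0"])
        show "?B \<subseteq> ?R" using 4 assms by (simp add: mem_stair)
      next
        fix a b assume "(a, b) \<in> ?R" "(a, b) \<notin> ?B"
        then show "Suc (Suc c) < a \<or> a = Suc (Suc c) \<and> 0 < b"
          by (elim stair_cases) (use 4 assms in auto)
      qed auto
      show "toric_indep ?B" by (rule toric_indep_121)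
    qed (use 4 assms in simp_all)
  next
    case 5
    let ?B = "{(c, Suc (Suc 0)), (Suc c, 0), (Suc c, Suc 0), (Suc (Suc c), 0)}"
    show ?thesis
    proof (rule step)
      show "?R - ?B = stair d (Suc (Suc c)) (Suc 0) 0"
        by (rule stair_diffI; erule stair_cases) (use 5 assms in \<open>auto simp: mem_stair\<close>)
      show "lowest ?B ?R"
      proof (rule lowest_lex[where e = "Suc (Suc c)" and f = "0"])
        show "?B \<subseteq> ?R" using 5 assms by (simp add: mem_stair)
      next
        fix a b assume "(a, b) \<in> ?R" "(a, b) \<notin> ?B"
        then show "Suc (Suc c) < a \<or> a = Suc (Suc c) \<and> 0 < b"
          by (elim stair_cases) (use 5 assms in auto)
      qed auto
      show "toric_indep ?B" by (rule toric_indep_121)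
    qed (use 5 assms in simp_all)
  next
    case 6
    let ?B = "{(c, 0), (c, Suc 0), (c, Suc (Suc 0)), (Suc c, 0)}"
    have sub: "?R \<subseteq> ?B" using 6 by (auto simp: stair_def)
    then have "card ?R \<le> card ?B" by (intro card_mono) auto
    moreover have "toric_indep ?R"
      by (rule toric_indep_subset[OF toric_indep_31 _ sub]) auto
    ultimately show ?thesis by simp
  qed
qed

text \<open>An exhausted column \<open>c\<close> is dropped: column \<open>c + 1\<close> takes over
  with its gap \<beta>, and column \<open>c + 2\<close> is still untouched. This restores
  \<open>c + \<alpha> \<le> d\<close> when a step of \<open>stair_step\<close> ends with
  \<open>Suc d\<close>.\<close>

lemma stair_normalize:
  assumes "3 * \<beta> \<le> \<alpha>" "c + \<alpha> = Suc d"
  shows "stair d c \<alpha> \<beta> = {} \<or> stair d c \<alpha> \<beta> = stair d (Suc c) \<beta> 0 \<and> Suc c + \<beta> \<le> d"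
  by (cases "Suc c + \<beta> \<le> d") (use assms in \<open>auto simp: stair_def\<close>)

text \<open>Induction on the number of squares: the last one takes a lowest quadruple
  \<open>B\<close>, the others are placed by the induction hypothesis on the rest. A set lowest in
  the whole staircase stays lowest in the subset \<open>A \<union> B\<close>.\<close>

lemma imposes_stair:
  assumes "3 * \<beta> \<le> \<alpha>" "c + \<alpha> \<le> Suc d"
  shows "\<exists>A\<subseteq>stair d c \<alpha> \<beta>. card A = min (card (stair d c \<alpha> \<beta>)) (4 * s) \<and> (\<exists>prm. imposes prm s A)"
  using assms
proof (induction s arbitrary: c \<alpha> \<beta>)
  case 0
  then show ?case using imposes_empty by (intro exI[of _ "{}"]) simp
next
  case (Suc s)
  have main: "\<exists>A\<subseteq>stair d c \<alpha> \<beta>. card A = min (card (stair d c \<alpha> \<beta>)) (4 * Suc s) \<and> (\<exists>prm. imposes prm (Suc s) A)"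
    if asm: "3 * \<beta> \<le> \<alpha>" "c + \<alpha> \<le> d" for c \<alpha> \<beta>
  proof -
    let ?R = "stair d c \<alpha> \<beta>"
    from stair_step[OF asm] show ?thesis
    proof (elim disjE exE conjE)
      assume card: "card ?R \<le> 4" and ind: "toric_indep ?R"
      obtain prm where "imposes prm s {}" using imposes_empty by blast
      then have "\<exists>prm'. imposes prm' (Suc s) ?R"
        using imposes_peel[of ?R ?R] ind finite_stair by auto
      then show ?thesis using card by (intro exI[of _ ?R]) auto
    next
      fix B c' \<alpha>' \<beta>'
      assume B: "card B = 4" "toric_indep B" "lowest B ?R" and R': "?R - B = stair d c' \<alpha>' \<beta>'"
        and st: "3 * \<beta>' \<le> \<alpha>'" "c' + \<alpha>' \<le> Suc d"
      obtain w1 w2 where sub: "B \<subseteq> ?R"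
        and w: "\<forall>b\<in>B. \<forall>a\<in>?R - B. w1 * fst b + w2 * snd b < w1 * fst a + w2 * snd a"
        using B(3) unfolding lowest_def by blast
      obtain A prm where A: "A \<subseteq> ?R - B" "card A = min (card (?R - B)) (4 * s)" "imposes prm s A"
        using Suc.IH[OF st] unfolding R' by blast
      have fin: "finite A" "finite B" using A(1) sub finite_stair finite_subset by (metis finite_Diff)+
      have diff: "(A \<union> B) - B = A" using A(1) by auto
      have "card (?R - B) = card ?R - 4" "card ?R \<ge> 4"
        using card_Diff_subset[OF fin(2) sub] card_mono[OF finite_stair sub] B(1) by auto
      moreover have "card (A \<union> B) = card A + 4"
        using card_Un_disjoint[OF fin] A(1) B(1) by auto
      ultimately have "card (A \<union> B) = min (card ?R) (4 * Suc s)" using A(2) by (cases "card (?R - B) \<le> 4 * s") simp_all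
      moreover have "\<exists>prm'. imposes prm' (Suc s) (A \<union> B)"
        by (rule imposes_peel[of _ B prm s w1 w2]) (use fin B A w in \<open>auto simp: diff\<close>)
      ultimately show ?thesis using A(1) sub by (intro exI[of _ "A \<union> B"]) auto
    qed
  qed
  show ?case
  proof (cases "c + \<alpha> \<le> d")
    case True
    then show ?thesis using main Suc.prems by blast
  next
    case False
    then have "c + \<alpha> = Suc d" using Suc.prems by simp
    from stair_normalize[OF Suc.prems(1) this] show ?thesis
    proof (elim disjE conjE)
      assume "stair d c \<alpha> \<beta> = {}"
      then show ?thesis using imposes_empty by simp
    next
      assume eq: "stair d c \<alpha> \<beta> = stair d (Suc c) \<beta> 0" and "Suc c + \<beta> \<le> d"
      then show ?thesis unfolding eq by (intro main) auto
    qed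
  qed
qed

section \<open>The dimension of the linear system\<close>

lemma card_stair: "card (stair d 0 0 0) = (d + 2) choose 2"
proof -
  have "stair d 0 0 0 = Sigma {..d} (\<lambda>a. {..d - a})" by (auto simp: stair_def)
  then have "card (stair d 0 0 0) = (\<Sum>a\<le>d. Suc (d - a))" by simp
  also have "\<dots> = (d + 2) choose 2"
    by (induction d) (simp_all add: sum.atMost_Suc_shift numeral_2_eq_2 del: sum.atMost_Suc)
  finally show ?thesis .
qed

text \<open>Restores the exponent of z after dehomogenising; the subtraction is faithful for points
  with a + b \<le> d.\<close>

definition expo :: "nat \<Rightarrow> nat \<times> nat \<Rightarrow> nat \<times> nat \<times> nat" where
  "expo d m = (fst m, snd m, d - fst m - snd m)"

lemma ev_form:
  assumes "is_form d (lookup f)"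
  shows "ev X Y f = (\<Sum>m\<in>stair d 0 0 0. sconst (lookup f (expo d m)) * (X ^ fst m * Y ^ snd m))"
proof -
  have "inj_on (expo d) (stair d 0 0 0)" by (auto simp: inj_on_def expo_def)
  moreover have "keys f \<subseteq> expo d ` stair d 0 0 0"
  proof
    fix m assume m: "m \<in> keys f"
    obtain a b c where abc: "m = (a, b, c)" by (cases m)
    then have "a + b + c = d" using assms m unfolding is_form_def by (simp add: in_keys_iff)
    then have "m = expo d (a, b)" "(a, b) \<in> stair d 0 0 0" by (auto simp: abc expo_def mem_stair)
    then show "m \<in> expo d ` stair d 0 0 0" by blast
  qed
  then have "ev X Y f = (\<Sum>m\<in>expo d ` stair d 0 0 0. sconst (lookup f m) * (X ^ fst m * Y ^ fst (snd m)))"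
    by (intro ev_superset) (simp_all add: finite_stair)
  ultimately show ?thesis
    by (simp only: sum.reindex o_def) (simp add: expo_def)
qed

lemma is_form_is_poly3: "is_form d F \<Longrightarrow> is_poly3 F"
  unfolding is_poly3_def is_form_def
  by (rule finite_subset[of _ "{..d} \<times> {..d} \<times> {..d}"]) fastforce+

lemma sq_line_pline:
  "sq_line prm i 0 = lookup (pline (prm (4 * i)) (prm (4 * i + 1)) (prm (4 * i + 2)))"
  "sq_line prm i 1 = lookup (pline (prm (4 * i)) (prm (4 * i + 1)) (prm (4 * i + 3)))"
  by (simp_all add: sq_line_def pline_def lookup_lform Let_def numeral_3_eq_3)

lemma IX_d_iff:
  assumes "\<And>i. i < s \<Longrightarrow> prm (4 * i + 2) \<noteq> prm (4 * i + 3)"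
  shows "F \<in> IX_d s prm d \<longleftrightarrow> is_form d F \<and>
    (\<forall>r\<in>{..<s} \<times> {..<4}. (\<Sum>m\<in>stair d 0 0 0. sel (snd r) (sqmon prm (fst r) m) * F (expo d m)) = 0)"
proof (cases "is_form d F")
  case True
  then obtain f where f: "F = lookup f" using is_form_is_poly3 is_poly3_lookup by blast
  have "in_ideal_sq (sq_line prm i 0) (sq_line prm i 1) F \<longleftrightarrow>
      (\<Sum>m\<in>stair d 0 0 0. sconst (F (expo d m)) * sqmon prm i m) = 0" if "i < s" for i
    using in_ideal_sq_iff_ev[OF assms[OF that]] ev_form True
    unfolding f sq_line_pline sqmon_def sqX_def sqY_def by simp
  then show ?thesis
    using True imposes_rows[of s "\<lambda>m. F (expo d m)" prm "stair d 0 0 0"] by (auto simp: IX_d_def)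
qed (simp add: IX_d_def)

lemma sum_fun_app: "(\<Sum>i\<in>I. f i) x = (\<Sum>i\<in>I. f i x)" for f :: "'i \<Rightarrow> 'x \<Rightarrow> complex"
  by (induction I rule: infinite_finite_induct) auto

lemma vector_space_cscale: "vector_space cscale"
  by standard (auto simp: cscale_def fun_eq_iff algebra_simps)

text \<open>The forms \<open>g m\<close> with \<open>m\<close> outside \<open>A\<close> are a basis:
  \<open>g m\<close> is the monomial \<open>m\<close> corrected by monomials from \<open>A\<close>.
  The identity \<open>right\<close> puts them into the linear system, and \<open>left\<close> shows
  that its elements are determined by their coefficients off \<open>A\<close>.\<close>

lemma cdim_IX_d:
  fixes prm :: "nat \<Rightarrow> complex" and E :: "nat \<times> nat \<Rightarrow> nat \<times> nat \<Rightarrow> complex"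
  defines "E \<equiv> \<lambda>r m. sel (snd r) (sqmon prm (fst r) m)"
  assumes ne: "\<And>i. i < s \<Longrightarrow> prm (4 * i + 2) \<noteq> prm (4 * i + 3)"
    and A: "A \<subseteq> stair d 0 0 0" "card A = min ((d + 2) choose 2) (4 * s)"
    and R: "R \<subseteq> {..<s} \<times> {..<4}" "card R = card A" and "\<Phi> \<noteq> 0"
    and left: "\<And>a a'. a \<in> A \<Longrightarrow> a' \<in> A \<Longrightarrow> (\<Sum>r\<in>R. c a r * E r a') = (if a = a' then \<Phi> else 0)"
    and right: "\<And>r r'. r \<in> R \<Longrightarrow> r' \<in> R \<Longrightarrow> (\<Sum>a\<in>A. E r a * c a r') = (if r = r' then \<Phi> else 0)"
  shows "cdim (IX_d s prm d) = ((d + 2) choose 2) - card A"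
proof -
  interpret cpoly3: vector_space cscale by (rule vector_space_cscale)
  define T where "T = stair d 0 0 0"
  define I where "I = {..<s} \<times> {..<4::nat}"
  have finT [simp]: "finite T" by (simp add: T_def finite_stair)
  have finA [simp]: "finite A" using A(1) finT finite_subset unfolding T_def by blast
  have finR [simp]: "finite R" using R(1) by (rule finite_subset) simp
  have AT: "A \<subseteq> T" using A(1) by (simp add: T_def)
  have IX: "F \<in> IX_d s prm d \<longleftrightarrow> is_form d F \<and> (\<forall>r\<in>I. (\<Sum>m\<in>T. E r m * F (expo d m)) = 0)" for F
    using IX_d_iff[OF ne] unfolding T_def I_def E_def by blast
  \<comment> \<open>Cramer's rule: \<open>k m\<close> expresses column \<open>m\<close> through the
    columns in \<open>A\<close>, on the rows in \<open>R\<close>.\<close>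
  define k where "k m a = (\<Sum>r\<in>R. c a r * E r m) / \<Phi>" for m a
  define g where "g m = (\<lambda>(a, b, e). if a + b + e \<noteq> d then 0 else if (a, b) = m then 1
    else if (a, b) \<in> A then - k m (a, b) else 0)" for m
  have g_expo: "g m (expo d a) = (if a = m then 1 else if a \<in> A then - k m a else 0)" if "a \<in> T" for m a
    using that by (cases a) (auto simp: g_def expo_def T_def mem_stair)
  have form_eqI: "F = G" if "is_form d F" "is_form d G" "\<And>m. m \<in> T \<Longrightarrow> F (expo d m) = G (expo d m)" for F G
  proof (rule ext, clarify)
    fix a b e
    show "F (a, b, e) = G (a, b, e)"
    proof (cases "a + b + e = d")
      case True
      then have "(a, b) \<in> T" "(a, b, e) = expo d (a, b)" by (auto simp: T_def mem_stair expo_def)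
      then show ?thesis using that(3) by metis
    next
      case False
      then show ?thesis using that(1,2) unfolding is_form_def by metis
    qed
  qed
  have g_form: "is_form d (g m)" for m by (auto simp: is_form_def g_def split: if_splits)
  have g_IX: "g m \<in> IX_d s prm d" if m: "m \<in> T - A" for m
    unfolding IX
  proof (intro conjI g_form ballI)
    fix r assume "r \<in> I"
    \<comment> \<open>A monomial outside \<open>A\<close> exists only if
      \<open>card A = 4 * s\<close>. Then \<open>R\<close> consists of all conditions, so the
      correction meets every one of them.\<close>
    have "card A < card T" using m AT by (intro psubset_card_mono) auto
    then have "card R = card I" using A(2) R(2) unfolding T_def card_stair I_def by simp
    then have "R = I" using R(1) unfolding I_def by (intro card_subset_eq) auto
    then have "r \<in> R" using \<open>r \<in> I\<close> by simp
    have "(\<Sum>a\<in>A. E r a * k m a) = (\<Sum>r'\<in>R. (\<Sum>a\<in>A. E r a * c a r') * E r' m) / \<Phi>"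
      by (simp add: k_def sum_distrib_left sum_distrib_right sum_divide_distrib mult.assoc) (rule sum.swap)
    also have "(\<Sum>r'\<in>R. (\<Sum>a\<in>A. E r a * c a r') * E r' m) = (\<Sum>r'\<in>R. if r = r' then \<Phi> * E r' m else 0)"
      by (intro sum.cong refl) (simp add: right[OF \<open>r \<in> R\<close>])
    also have "\<dots> = \<Phi> * E r m" using \<open>r \<in> R\<close> by simp
    finally have k: "(\<Sum>a\<in>A. E r a * k m a) = E r m" using \<open>\<Phi> \<noteq> 0\<close> by simp
    have "(\<Sum>a\<in>T. E r a * g m (expo d a)) = (\<Sum>a\<in>insert m A. E r a * g m (expo d a))"
      by (rule sum.mono_neutral_right) (use m AT in \<open>auto simp: g_expo\<close>)
    also have "\<dots> = E r m * g m (expo d m) + (\<Sum>a\<in>A. E r a * g m (expo d a))"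
      using m by simp
    also have "(\<Sum>a\<in>A. E r a * g m (expo d a)) = (\<Sum>a\<in>A. - (E r a * k m a))"
      by (intro sum.cong refl) (use m AT in \<open>auto simp: g_expo\<close>)
    finally show "(\<Sum>a\<in>T. E r a * g m (expo d a)) = 0"
      using m by (simp add: g_expo sum_negf k)
  qed
  have expand: "F = (\<Sum>m\<in>T - A. cscale (F (expo d m)) (g m))" if F: "F \<in> IX_d s prm d" for F
  proof (rule form_eqI)
    show "is_form d F" using F IX by blast
    show "is_form d (\<Sum>m\<in>T - A. cscale (F (expo d m)) (g m))"
      unfolding is_form_def
    proof (intro allI impI)
      fix a b e assume *: "(\<Sum>m\<in>T - A. cscale (F (expo d m)) (g m)) (a, b, e) \<noteq> 0"
      show "a + b + e = d"
      proof (rule ccontr)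
        assume "a + b + e \<noteq> d"
        then have "(\<Sum>m\<in>T - A. cscale (F (expo d m)) (g m)) (a, b, e) = 0"
          unfolding sum_fun_app cscale_def g_def by (intro sum.neutral) simp
        then show False using * by contradiction
      qed
    qed
    fix a assume a: "a \<in> T"
    show "F (expo d a) = (\<Sum>m\<in>T - A. cscale (F (expo d m)) (g m)) (expo d a)"
    proof (cases "a \<in> A")
      case False
      then have "(\<Sum>m\<in>T - A. cscale (F (expo d m)) (g m)) (expo d a) =
          (\<Sum>m\<in>T - A. if a = m then F (expo d m) else 0)"
        unfolding sum_fun_app cscale_def using a by (intro sum.cong refl) (simp add: g_expo)
      then show ?thesis using False a by simp
    next
      case True
      \<comment> \<open>Applying the adjugate \<open>c\<close> to the conditions in \<open>R\<close>
        solves for the coefficients on \<open>A\<close>.\<close>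
      have rows: "(\<Sum>m\<in>A. E r m * F (expo d m)) + (\<Sum>m\<in>T - A. E r m * F (expo d m)) = 0" if "r \<in> I" for r
        using F IX that AT sum.subset_diff[OF AT finT, of "\<lambda>m. E r m * F (expo d m)"] by (simp add: add.commute)
      have rel: "(\<Sum>m\<in>A. E r m * F (expo d m)) = - (\<Sum>m\<in>T - A. E r m * F (expo d m))" if "r \<in> R" for r
      proof -
        have "r \<in> I" using R(1) that unfolding I_def by blast
        then show ?thesis using rows by (simp add: add_eq_0_iff2)
      qed
      have k_eq: "(\<Sum>r\<in>R. c a r * E r m) = \<Phi> * k m a" for m
        using \<open>\<Phi> \<noteq> 0\<close> by (simp add: k_def)
      have "(\<Sum>r\<in>R. c a r * (\<Sum>m\<in>A. E r m * F (expo d m))) = (\<Sum>m\<in>A. (\<Sum>r\<in>R. c a r * E r m) * F (expo d m))"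
        by (simp add: sum_distrib_left sum_distrib_right mult.assoc) (rule sum.swap)
      also have "\<dots> = (\<Sum>m\<in>A. if a = m then \<Phi> * F (expo d m) else 0)"
        by (intro sum.cong refl) (simp add: left[OF True])
      also have "\<dots> = \<Phi> * F (expo d a)" using True by simp
      finally have "\<Phi> * F (expo d a) = (\<Sum>r\<in>R. c a r * - (\<Sum>m\<in>T - A. E r m * F (expo d m)))"
        using rel by simp
      also have "\<dots> = - (\<Sum>m\<in>T - A. F (expo d m) * (\<Sum>r\<in>R. c a r * E r m))"
        by (simp add: sum_distrib_left sum_negf mult_ac) (rule sum.swap)
      also have "\<dots> = \<Phi> * (\<Sum>m\<in>T - A. F (expo d m) * - k m a)"
        unfolding k_eq by (simp add: sum_distrib_left sum_negf mult_ac)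
      finally have "F (expo d a) = (\<Sum>m\<in>T - A. F (expo d m) * - k m a)" using \<open>\<Phi> \<noteq> 0\<close> by simp
      also have "\<dots> = (\<Sum>m\<in>T - A. cscale (F (expo d m)) (g m)) (expo d a)"
        unfolding sum_fun_app cscale_def using a True by (intro sum.cong refl) (auto simp: g_expo)
      finally show ?thesis .
    qed
  qed
  have g_eval: "g m (expo d m') = (if m' = m then 1 else 0)" if "m' \<in> T - A" for m m'
    using that by (simp add: g_expo)
  have inj: "inj_on g (T - A)"
    by (rule inj_onI) (metis g_eval zero_neq_one)
  show ?thesis
  proof (rule cpoly3.dim_unique)
    show "g ` (T - A) \<subseteq> IX_d s prm d" using g_IX by blast
    show "IX_d s prm d \<subseteq> cpoly3.span (g ` (T - A))"
      by (rule subsetI, subst expand, assumption)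
        (intro cpoly3.span_sum cpoly3.span_scale cpoly3.span_base imageI)
    show "cpoly3.independent (g ` (T - A))"
    proof (rule cpoly3.independent_if_scalars_zero)
      fix f x assume sum: "(\<Sum>x\<in>g ` (T - A). cscale (f x) x) = 0" and "x \<in> g ` (T - A)"
      then obtain m where m: "m \<in> T - A" "x = g m" by blast
      have "0 = (\<Sum>m'\<in>T - A. cscale (f (g m')) (g m')) (expo d m)"
        using sum by (simp add: sum.reindex[OF inj])
      also have "\<dots> = (\<Sum>m'\<in>T - A. if m = m' then f (g m') else 0)"
        unfolding sum_fun_app cscale_def using m by (intro sum.cong refl) (simp add: g_eval)
      also have "\<dots> = f x" using m by simp
      finally show "f x = 0" by simp
    qed simp
    show "card (g ` (T - A)) = ((d + 2) choose 2) - card A"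
      using card_image[OF inj] card_Diff_subset[OF finA AT] by (simp add: T_def card_stair)
  qed
qed

theorem theorem3p1:
  fixes s d :: nat
  assumes "s \<ge> 1"
  shows "\<exists>\<Phi> \<in> polyfun. (\<exists>prm. \<Phi> prm \<noteq> 0) \<and>
           (\<forall>prm. \<Phi> prm \<noteq> 0 \<longrightarrow>
              int (cdim (IX_d s prm d)) = max 0 (int ((d + 2) choose 2) - 4 * int s))"
proof -
  define E where "E p r m = sel (snd r) (sqmon p (fst r) m)" for p r m
  obtain A prm0 where A: "A \<subseteq> stair d 0 0 0" "card A = min ((d + 2) choose 2) (4 * s)"
    and prm0: "imposes prm0 s A"
    using imposes_stair[of 0 0 0 d s] card_stair by auto
  have fin: "finite A" "finite ({..<s} \<times> {..<4::nat})"
    using A(1) finite_stair finite_subset by blast+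
  have poly: "(\<lambda>p. E p r a) \<in> polyfun" for r a unfolding E_def by (rule polyfun_sqmon)
  have "\<forall>v. (\<forall>r\<in>{..<s} \<times> {..<4}. (\<Sum>a\<in>A. E prm0 r a * v a) = 0) \<longrightarrow> (\<forall>a\<in>A. v a = 0)"
    using prm0 unfolding imposes_def imposes_rows E_def by blast
  from generic_cramer[where E = E and ?p0.0 = prm0, OF fin poly this]
  obtain \<Phi> c R where \<Phi>: "\<Phi> \<in> polyfun" "\<Phi> prm0 \<noteq> 0"
    and R: "R \<subseteq> {..<s} \<times> {..<4}" "card R = card A"
    and "\<forall>a r. (\<lambda>p. c p a r) \<in> polyfun"
    and left: "\<forall>p. \<forall>a\<in>A. \<forall>a'\<in>A. (\<Sum>r\<in>R. c p a r * E p r a') = (if a = a' then \<Phi> p else 0)"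
    and right: "\<forall>p. \<forall>r\<in>R. \<forall>r'\<in>R. (\<Sum>a\<in>A. E p r a * c p a r') = (if r = r' then \<Phi> p else 0)"
    by (elim exE conjE)
  \<comment> \<open>The extra factor keeps the two lines of every square distinct, as the evaluation
    criterion requires.\<close>
  define \<Psi> where "\<Psi> p = \<Phi> p * (\<Prod>i<s. p (4 * i + 2) - p (4 * i + 3))" for p
  show ?thesis
  proof (intro bexI conjI exI allI impI)
    show "\<Psi> \<in> polyfun" unfolding \<Psi>_def by (intro polyfun_intros \<Phi>)
    show "\<Psi> prm0 \<noteq> 0" using \<Phi>(2) prm0 by (auto simp: \<Psi>_def imposes_def)
    fix prm assume nz: "\<Psi> prm \<noteq> 0"
    have "cdim (IX_d s prm d) = ((d + 2) choose 2) - card A"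
      by (rule cdim_IX_d[OF _ A R, where \<Phi> = "\<Phi> prm" and c = "c prm"])
        (use nz left right in \<open>auto simp: \<Psi>_def E_def\<close>)
    then show "int (cdim (IX_d s prm d)) = max 0 (int ((d + 2) choose 2) - 4 * int s)"
      using A(2) by (simp add: of_nat_diff)
  qed
qed

end
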